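(* Let $K$ be a field of characteristic zero, $A_1$ the first Weyl algebra over $K$, $Q(A_1)$ its classical quotient division ring, and $\mathbb{A}_1$ the Jacobian algebra in one variable. Then ${}'Q(\mathbb{A}_1)\simeq Q(A_1)$.
   Context: All rings are unital. A subset $S$ of a ring $R$ is multiplicative if $1\in S$, $SS\subseteq S$, $0\notin S$. A multiplicative set $S$ is a left Ore set if $Sr\cap Rs\neq\emptyset$ for all $r\in R$, $s\in S$; it is a left denominator set if moreover $rs=0$ ($r\in R$, $s\in S$) implies $tr=0$ for some $t\in S$; $S^{-1}R$ is the left localization. ${}'\mathcal{C}_R=\{c\in R\mid rc=0\Rightarrow r=0\}$ is the set of left regular elements; it contains a largest left denominator set of $R$, denoted ${}'S(R)$, and ${}'Q(R):={}'S(R)^{-1}R$ is the left regular left quotient ring of $R$. The symbol $\simeq$ denotes isomorphism of $K$-algebras. $A_1$ is the subalgebra of $\mathrm{End}_K(K[x])$ generated by multiplication by $x$ and $\partial=\frac{d}{dx}$. $\mathbb{A}_1$ is the subalgebra of $\mathrm{End}_K(K[x])$ generated by $A_1$ and the inverse $H^{-1}$ of the bijective map $H:=\partial x$ (so $H(x^k)=(k+1)x^k$). *)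

theory Defs
  imports
    "HOL-Algebra.QuotRing"
    "HOL-Algebra.Generated_Rings"
    "HOL-Algebra.Module"
    "HOL-Computational_Algebra.Polynomial"
begin

section \<open>Left Ore localization\<close>

definition multiplicative_set :: "('a, 'm) ring_scheme \<Rightarrow> 'a set \<Rightarrow> bool" where
  "multiplicative_set R S \<longleftrightarrow>
     S \<subseteq> carrier R \<and> \<one>\<^bsub>R\<^esub> \<in> S \<and> (\<forall>s\<in>S. \<forall>t\<in>S. s \<otimes>\<^bsub>R\<^esub> t \<in> S) \<and> \<zero>\<^bsub>R\<^esub> \<notin> S"

definition left_Ore_set :: "('a, 'm) ring_scheme \<Rightarrow> 'a set \<Rightarrow> bool" where
  "left_Ore_set R S \<longleftrightarrow> multiplicative_set R S \<and>
     (\<forall>r\<in>carrier R. \<forall>s\<in>S.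
        (\<lambda>t. t \<otimes>\<^bsub>R\<^esub> r) ` S \<inter> (\<lambda>a. a \<otimes>\<^bsub>R\<^esub> s) ` carrier R \<noteq> {})"

definition left_denominator_set :: "('a, 'm) ring_scheme \<Rightarrow> 'a set \<Rightarrow> bool" where
  "left_denominator_set R S \<longleftrightarrow> left_Ore_set R S \<and>
     (\<forall>r\<in>carrier R. \<forall>s\<in>S. r \<otimes>\<^bsub>R\<^esub> s = \<zero>\<^bsub>R\<^esub> \<longrightarrow> (\<exists>t\<in>S. t \<otimes>\<^bsub>R\<^esub> r = \<zero>\<^bsub>R\<^esub>))"

text \<open>
  The pair \<open>(s, r)\<close> stands for the left fraction \<open>s\<^sup>-\<^sup>1 r\<close>.  Two fractions are equal iff they
  can be brought to a common denominator \<open>a s = b s' \<in> S\<close> with equal numerators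
  \<open>a r = b r'\<close>; the multipliers \<open>a\<close>, \<open>b\<close> themselves need not lie in \<open>S\<close>.
\<close>

definition left_frac_rel ::
    "('a, 'm) ring_scheme \<Rightarrow> 'a set \<Rightarrow> (('a \<times> 'a) \<times> ('a \<times> 'a)) set" where
  "left_frac_rel R S =
     {((s, r), (s', r')) | s r s' r'.
        s \<in> S \<and> r \<in> carrier R \<and> s' \<in> S \<and> r' \<in> carrier R \<and>
        (\<exists>a\<in>carrier R. \<exists>b\<in>carrier R.
           a \<otimes>\<^bsub>R\<^esub> s = b \<otimes>\<^bsub>R\<^esub> s' \<and> a \<otimes>\<^bsub>R\<^esub> s \<in> S \<and> a \<otimes>\<^bsub>R\<^esub> r = b \<otimes>\<^bsub>R\<^esub> r')}"

definition left_frac :: "('a, 'm) ring_scheme \<Rightarrow> 'a set \<Rightarrow> 'a \<Rightarrow> 'a \<Rightarrow> ('a \<times> 'a) set" where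
  "left_frac R S s r = left_frac_rel R S `` {(s, r)}"

text \<open>
  The localization \<open>S\<^sup>-\<^sup>1 R\<close> of a \<open>K\<close>-algebra \<open>R\<close> at a left denominator set \<open>S\<close>.  Algebras over the
  field \<open>'k\<close> are records of type \<^typ>\<open>('k, 'a) module\<close>, i.e. rings with a scalar multiplication.
  The operations are
  \<open>s\<^sup>-\<^sup>1 r \<cdot> s'\<^sup>-\<^sup>1 r' = (t s)\<^sup>-\<^sup>1 (a r')\<close> where \<open>t r = a s'\<close> and \<open>t \<in> S\<close>,
  \<open>s\<^sup>-\<^sup>1 r + s'\<^sup>-\<^sup>1 r' = (a s)\<^sup>-\<^sup>1 (a r + b r')\<close> where \<open>a s = b s' \<in> S\<close>, and
  \<open>k \<odot> s\<^sup>-\<^sup>1 r = s\<^sup>-\<^sup>1 (k \<odot> r)\<close>.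
  Each union below runs over all representatives and all admissible multipliers; for a left
  denominator set \<open>S\<close> the classes so united all coincide.
\<close>

definition left_localization ::
    "('k, 'a, 'm) module_scheme \<Rightarrow> 'a set \<Rightarrow> ('k, ('a \<times> 'a) set) module" where
  "left_localization R S =
     \<lparr> carrier = (S \<times> carrier R) // left_frac_rel R S,
       monoid.mult = (\<lambda>X Y. \<Union>{left_frac R S (t \<otimes>\<^bsub>R\<^esub> s) (a \<otimes>\<^bsub>R\<^esub> r') | s r s' r' t a.
                 (s, r) \<in> X \<and> (s', r') \<in> Y \<and> t \<in> S \<and> a \<in> carrier R \<and>
                 t \<otimes>\<^bsub>R\<^esub> r = a \<otimes>\<^bsub>R\<^esub> s'}),
       one = left_frac R S \<one>\<^bsub>R\<^esub> \<one>\<^bsub>R\<^esub>,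
       zero = left_frac R S \<one>\<^bsub>R\<^esub> \<zero>\<^bsub>R\<^esub>,
       add = (\<lambda>X Y. \<Union>{left_frac R S (a \<otimes>\<^bsub>R\<^esub> s) ((a \<otimes>\<^bsub>R\<^esub> r) \<oplus>\<^bsub>R\<^esub> (b \<otimes>\<^bsub>R\<^esub> r')) | s r s' r' a b.
                 (s, r) \<in> X \<and> (s', r') \<in> Y \<and> a \<in> carrier R \<and> b \<in> carrier R \<and>
                 a \<otimes>\<^bsub>R\<^esub> s = b \<otimes>\<^bsub>R\<^esub> s' \<and> a \<otimes>\<^bsub>R\<^esub> s \<in> S}),
       module.smult = (\<lambda>k X. \<Union>{left_frac R S s (k \<odot>\<^bsub>R\<^esub> r) | s r. (s, r) \<in> X}) \<rparr>"


section \<open>Quotient rings\<close>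

definition left_regular_elements :: "('a, 'm) ring_scheme \<Rightarrow> 'a set" where
  "left_regular_elements R =
     {c \<in> carrier R. \<forall>r\<in>carrier R. r \<otimes>\<^bsub>R\<^esub> c = \<zero>\<^bsub>R\<^esub> \<longrightarrow> r = \<zero>\<^bsub>R\<^esub>}"

definition regular_elements :: "('a, 'm) ring_scheme \<Rightarrow> 'a set" where
  "regular_elements R =
     {c \<in> carrier R. \<forall>r\<in>carrier R.
        (r \<otimes>\<^bsub>R\<^esub> c = \<zero>\<^bsub>R\<^esub> \<longrightarrow> r = \<zero>\<^bsub>R\<^esub>) \<and> (c \<otimes>\<^bsub>R\<^esub> r = \<zero>\<^bsub>R\<^esub> \<longrightarrow> r = \<zero>\<^bsub>R\<^esub>)}"

text \<open>\<open>'S(R)\<close>: the largest left denominator set contained in the set of left regular elements.\<close>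

definition largest_left_regular_denominator_set :: "('a, 'm) ring_scheme \<Rightarrow> 'a set" where
  "largest_left_regular_denominator_set R =
     (GREATEST S. left_denominator_set R S \<and> S \<subseteq> left_regular_elements R)"

text \<open>\<open>'Q(R)\<close>\<close>

definition left_regular_left_quotient_ring ::
    "('k, 'a, 'm) module_scheme \<Rightarrow> ('k, ('a \<times> 'a) set) module" where
  "left_regular_left_quotient_ring R =
     left_localization R (largest_left_regular_denominator_set R)"

text \<open>\<open>Q(R)\<close>, as a ring of left fractions with regular denominators\<close>

definition classical_left_quotient_ring ::
    "('k, 'a, 'm) module_scheme \<Rightarrow> ('k, ('a \<times> 'a) set) module" where
  "classical_left_quotient_ring R = left_localization R (regular_elements R)"

definition algebra_isomorphic ::
    "('k, 'a, 'm) module_scheme \<Rightarrow> ('k, 'b, 'n) module_scheme \<Rightarrow> bool" where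
  "algebra_isomorphic A B \<longleftrightarrow>
     (\<exists>f\<in>ring_iso A B. \<forall>k. \<forall>x\<in>carrier A. f (k \<odot>\<^bsub>A\<^esub> x) = k \<odot>\<^bsub>B\<^esub> f x)"


section \<open>The Weyl algebra and the Jacobian algebra\<close>

definition End_poly :: "('k::field, 'k poly \<Rightarrow> 'k poly) module" where
  "End_poly =
     \<lparr> carrier = {f. Vector_Spaces.linear Polynomial.smult Polynomial.smult f},
       monoid.mult = (\<lambda>f g. f \<circ> g),
       one = id,
       zero = (\<lambda>p. 0),
       add = (\<lambda>f g p. f p + g p),
       module.smult = (\<lambda>k f p. Polynomial.smult k (f p)) \<rparr>"

text \<open>The \<open>K\<close>-subalgebra generated by \<open>X\<close> is the subring generated by \<open>X\<close> and the scalars.\<close>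

definition generate_algebra :: "('k, 'a, 'm) module_scheme \<Rightarrow> 'a set \<Rightarrow> 'a set" where
  "generate_algebra A X = generate_ring A (X \<union> range (\<lambda>k. k \<odot>\<^bsub>A\<^esub> \<one>\<^bsub>A\<^esub>))"

definition mult_X :: "'k::field poly \<Rightarrow> 'k poly" where
  "mult_X p = [:0, 1:] * p"

definition Weyl_algebra :: "('k::field, 'k poly \<Rightarrow> 'k poly) module" where
  "Weyl_algebra = End_poly \<lparr> carrier := generate_algebra End_poly {mult_X, pderiv} \<rparr>"

definition H_op :: "'k::field poly \<Rightarrow> 'k poly" where
  "H_op = pderiv \<circ> mult_X"

text \<open>\<^const>\<open>H_op\<close> sends \<open>x\<^sup>k\<close> to \<open>(k + 1) x\<^sup>k\<close>, hence is bijective in characteristic zero.\<close>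

definition Jacobian_algebra :: "('k::field_char_0, 'k poly \<Rightarrow> 'k poly) module" where
  "Jacobian_algebra =
     End_poly \<lparr> carrier :=
       generate_algebra End_poly (carrier Weyl_algebra \<union> {the_inv H_op}) \<rparr>"

end

theory Submission
  imports Defs
begin

text \<open>
  Let \<open>A\<close> be the Weyl algebra, \<open>R\<close> the Jacobian algebra and \<open>S\<close> the set of all left regular
  elements of \<open>R\<close>.  The algebra \<open>A\<close> is a left Ore domain (growth of dimensions), and since
  \<open>R\<close> is generated over \<open>A\<close> by an inverse of an element of \<open>A\<close>, every \<open>r\<close> in \<open>R\<close> has a nonzero
  left multiplier \<open>u\<close> in \<open>A\<close> with \<open>u r\<close> in \<open>A\<close>.  If \<open>t\<close> in \<open>A\<close> is nonzero, then \<open>\<partial>\<^sup>a t\<close> lies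
  in \<open>S\<close> for large \<open>a\<close>: the lowest homogeneous component of \<open>t\<close> shows that the image of \<open>\<partial>\<^sup>a t\<close>
  contains polynomials of every order of vanishing at \<open>0\<close>, while an \<open>r\<close> in \<open>R\<close> that kills this image is
  killed on the left by some nonzero \<open>u\<close> in \<open>A\<close> and hence vanishes on \<open>x\<^sup>k\<close> for large \<open>k\<close>.
  Consequently \<open>S\<close> is itself a left Ore set, so that it is \<open>'S(R)\<close>, and every
  fraction over \<open>R\<close> can be rewritten with numerator and denominator in \<open>A\<close>.
\<close>

section \<open>Localization at right cancellable left Ore sets\<close>

text \<open>The obstacle is that the Jacobian algebra is not a domain and that left and right
  regularity differ in it. The operator \<open>P = id - x H^-1 \<partial>\<close> belongs to it and
  projects onto the constants, with \<open>P x = 0\<close> and \<open>\<partial> P = 0\<close>.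
  Hence \<open>x\<close> is a nonzero element of \<open>A\<close> outside \<open>S\<close>, while
  \<open>\<partial>\<close>, being surjective, lies in \<open>S\<close> although it kills
  \<open>P\<close> from the left. Two consequences shape the proof. Neither of the two denominator
  sets contains the other, so the localizations are compared through \<open>S \<inter> A\<close>.
  And the map from \<open>R\<close> to its localization has a kernel, so equal fractions have equal
  numerators only after a further factor from \<open>S\<close>; for this reason the locale assumes
  cancellation of members of \<open>S\<close> on the right alone. Denominators on the right serve a
  single purpose: an operator \<open>r\<close> with \<open>u r = 0\<close> is recognized as
  eventually zero by clearing it from the right with polynomials in \<open>x\<partial>\<close>,
  which are diagonal on monomials.\<close>

locale cancellative_left_Ore_set = ring R
  for R :: "('k, 'a, 'm) module_scheme" (structure) +
  fixes S :: "'a set"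
  assumes S_subset: "S \<subseteq> carrier R"
    and one_in_S: "\<one> \<in> S"
    and mult_in_S: "s \<in> S \<Longrightarrow> t \<in> S \<Longrightarrow> s \<otimes> t \<in> S"
    and Ore: "r \<in> carrier R \<Longrightarrow> s \<in> S \<Longrightarrow> \<exists>t\<in>S. \<exists>a\<in>carrier R. t \<otimes> r = a \<otimes> s"
    and right_cancel: "a \<in> carrier R \<Longrightarrow> b \<in> carrier R \<Longrightarrow> s \<in> S \<Longrightarrow> a \<otimes> s = b \<otimes> s \<Longrightarrow> a = b"
    and smult_closed: "r \<in> carrier R \<Longrightarrow> k \<odot> r \<in> carrier R"
    and mult_smult: "a \<in> carrier R \<Longrightarrow> r \<in> carrier R \<Longrightarrow> a \<otimes> (k \<odot> r) = k \<odot> (a \<otimes> r)"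
begin

abbreviation frac_eq :: "'a \<times> 'a \<Rightarrow> 'a \<times> 'a \<Rightarrow> bool" (infix "\<approx>" 50) where
  "p \<approx> q \<equiv> (p, q) \<in> left_frac_rel R S"

lemma S_carrier [simp]: "s \<in> S \<Longrightarrow> s \<in> carrier R"
  using S_subset by blast

lemma frac_eq_iff:
  "(s, r) \<approx> (s', r') \<longleftrightarrow> s \<in> S \<and> r \<in> carrier R \<and> s' \<in> S \<and> r' \<in> carrier R \<and>
     (\<exists>a\<in>carrier R. \<exists>b\<in>carrier R. a \<otimes> s = b \<otimes> s' \<and> a \<otimes> s \<in> S \<and> a \<otimes> r = b \<otimes> r')"
  unfolding left_frac_rel_def by blast

lemma frac_eqI:
  assumes "s \<in> S" "r \<in> carrier R" "s' \<in> S" "r' \<in> carrier R" "a \<in> carrier R" "b \<in> carrier R"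
    "a \<otimes> s = b \<otimes> s'" "a \<otimes> s \<in> S" "a \<otimes> r = b \<otimes> r'"
  shows "(s, r) \<approx> (s', r')"
  using assms unfolding frac_eq_iff by blast

lemma frac_eq_expand:
  assumes "s \<in> S" "r \<in> carrier R" "u \<in> carrier R" "u \<otimes> s \<in> S"
  shows "(s, r) \<approx> (u \<otimes> s, u \<otimes> r)"
  by (rule frac_eqI[where a = u and b = \<one>]) (use assms in auto)

text \<open>The Ore condition gives \<open>u a s = v c s\<close> for the given \<open>a\<close> and
  the multiplier \<open>c\<close> witnessing the equality; cancelling \<open>s\<close> and
  \<open>s'\<close> on the right yields \<open>u a = v c\<close> and \<open>u b = v d\<close>, so
  \<open>t = u\<close> works. The factor \<open>t\<close> remains because members of
  \<open>S\<close> need not cancel on the left.\<close>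

lemma frac_eq_multipliers:
  assumes eq: "(s, r) \<approx> (s', r')"
    and a: "a \<in> carrier R" and b: "b \<in> carrier R" and ab: "a \<otimes> s = b \<otimes> s'"
  shows "\<exists>t\<in>S. t \<otimes> (a \<otimes> r) = t \<otimes> (b \<otimes> r')"
proof -
  obtain c d where s: "s \<in> S" "s' \<in> S" and r: "r \<in> carrier R" "r' \<in> carrier R"
    and cd: "c \<in> carrier R" "d \<in> carrier R" "c \<otimes> s = d \<otimes> s'" "c \<otimes> s \<in> S" "c \<otimes> r = d \<otimes> r'"
    using eq unfolding frac_eq_iff by blast
  obtain u v where u: "u \<in> S" "v \<in> carrier R" "u \<otimes> (a \<otimes> s) = v \<otimes> (c \<otimes> s)"
    using Ore[of "a \<otimes> s" "c \<otimes> s"] a s cd by auto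
  have "u \<otimes> a = v \<otimes> c"
    by (rule right_cancel[of _ _ s]) (use u a s cd in \<open>auto simp: m_assoc\<close>)
  moreover have "u \<otimes> b = v \<otimes> d"
  proof (rule right_cancel[of _ _ s'])
    have "u \<otimes> (b \<otimes> s') = v \<otimes> (d \<otimes> s')"
      using u(3) unfolding ab cd(3) .
    then show "u \<otimes> b \<otimes> s' = v \<otimes> d \<otimes> s'"
      using u b s cd by (simp add: m_assoc)
  qed (use u b s cd in auto)
  ultimately have "u \<otimes> (a \<otimes> r) = v \<otimes> (c \<otimes> r)" "u \<otimes> (b \<otimes> r') = v \<otimes> (d \<otimes> r')"
    using u(1,2) a b r cd(1,2) by (simp_all add: m_assoc[symmetric])
  then show ?thesis
    using u(1) cd(5) by metis
qed

lemma frac_eq_equiv: "equiv (S \<times> carrier R) (left_frac_rel R S)"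
proof (rule equivI)
  show "left_frac_rel R S \<subseteq> (S \<times> carrier R) \<times> (S \<times> carrier R)"
    by (auto simp: left_frac_rel_def)
  show "refl_on (S \<times> carrier R) (left_frac_rel R S)"
  proof (rule refl_onI)
    fix p assume "p \<in> S \<times> carrier R"
    then show "p \<approx> p"
      by (cases p) (auto intro!: frac_eqI[where a = \<one> and b = \<one>])
  qed
  show "sym (left_frac_rel R S)"
  proof (rule symI)
    fix p q assume "p \<approx> q"
    then obtain s r s' r' a b where "p = (s, r)" "q = (s', r')" and
      "s \<in> S" "r \<in> carrier R" "s' \<in> S" "r' \<in> carrier R"  "a \<in> carrier R" "b \<in> carrier R"
      "a \<otimes> s = b \<otimes> s'" "a \<otimes> s \<in> S" "a \<otimes> r = b \<otimes> r'"
      unfolding left_frac_rel_def by blast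
    then show "q \<approx> p"
      by (auto intro!: frac_eqI[where a = b and b = a])
  qed
  show "trans (left_frac_rel R S)"
  proof (rule transI)
    fix p q w assume pq: "p \<approx> q" and qw: "q \<approx> w"
    obtain s r s' r' a b where p: "p = (s, r)" and q: "q = (s', r')" and
      1: "s \<in> S" "r \<in> carrier R" "s' \<in> S" "r' \<in> carrier R" "a \<in> carrier R" "b \<in> carrier R"
      "a \<otimes> s = b \<otimes> s'" "a \<otimes> s \<in> S" "a \<otimes> r = b \<otimes> r'"
      using pq unfolding left_frac_rel_def by blast
    obtain s'' r'' where w: "w = (s'', r'')"
      by (cases w)
    obtain c d where
      2: "s'' \<in> S" "r'' \<in> carrier R" "c \<in> carrier R" "d \<in> carrier R"
      "c \<otimes> s' = d \<otimes> s''" "c \<otimes> s' \<in> S" "c \<otimes> r' = d \<otimes> r''"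
      using qw unfolding q w frac_eq_iff by blast
    \<comment> \<open>The two equalities have unrelated common denominators \<open>a s\<close> and
      \<open>c s'\<close>. A common left multiple of them joins the chains, and
      \<open>u \<in> S\<close> keeps the new denominator in \<open>S\<close>.\<close>
    obtain u v where u: "u \<in> S" "v \<in> carrier R" "u \<otimes> (a \<otimes> s) = v \<otimes> (c \<otimes> s')"
      using Ore[of "a \<otimes> s" "c \<otimes> s'"] 1 2 by auto
    have ub: "u \<otimes> b = v \<otimes> c"
      by (rule right_cancel[of _ _ s']) (use u(3) u(1,2) 1 2 in \<open>simp_all add: m_assoc\<close>)
    have "u \<otimes> (b \<otimes> r') = v \<otimes> (c \<otimes> r')"
      using ub u(1,2) 1(1-6) 2(1-4) by (simp add: m_assoc[symmetric])
    then have "(s, r) \<approx> (s'', r'')"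
      using u(1,2) mult_in_S[OF u(1) 1(8)] 1(1-6) 2(1-4) u(3)[unfolded 2(5)] 1(9) 2(7)
      by (intro frac_eqI[where a = "u \<otimes> a" and b = "v \<otimes> d"]) (simp_all add: m_assoc)
    then show "p \<approx> w"
      unfolding p w .
  qed
qed

text \<open>Converse companion of \<open>frac_eq_multipliers\<close>: the extra factor
  \<open>t\<close> is absorbed into both multipliers, and \<open>t (a s)\<close> is still in
  \<open>S\<close>.\<close>

lemma frac_eqI':
  assumes "s \<in> S" "r \<in> carrier R" "s' \<in> S" "r' \<in> carrier R" "a \<in> carrier R" "b \<in> carrier R"
    "a \<otimes> s = b \<otimes> s'" "a \<otimes> s \<in> S" "t \<in> S" "t \<otimes> (a \<otimes> r) = t \<otimes> (b \<otimes> r')"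
  shows "(s, r) \<approx> (s', r')"
  using assms mult_in_S[of t "a \<otimes> s"]
  by (intro frac_eqI[where a = "t \<otimes> a" and b = "t \<otimes> b"]) (auto simp: m_assoc)

text \<open>This makes the product independent of the representatives and of the multipliers
  \<open>t\<close>, \<open>a\<close>. After \<open>p\<close>, \<open>q\<close> equalize the outer
  denominators, \<open>frac_eq_multipliers\<close> is used twice, once for each factor.\<close>

lemma frac_mult_cong:
  assumes eq: "(s, r) \<approx> (s1, r1)" and eq': "(s', r') \<approx> (s1', r1')"
    and t: "t \<in> S" "a \<in> carrier R" "t \<otimes> r = a \<otimes> s'"
    and t1: "t1 \<in> S" "a1 \<in> carrier R" "t1 \<otimes> r1 = a1 \<otimes> s1'"
  shows "(t \<otimes> s, a \<otimes> r') \<approx> (t1 \<otimes> s1, a1 \<otimes> r1')"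
proof -
  have s [simp]: "s \<in> S" "s1 \<in> S" "s' \<in> S" "s1' \<in> S" 
    and r [simp]: "r \<in> carrier R" "r1 \<in> carrier R" "r' \<in> carrier R" "r1' \<in> carrier R"
    using eq eq' unfolding frac_eq_iff by blast+
  note t(1,2) [simp] t1(1,2) [simp]
  obtain p q where p [simp]: "p \<in> S" "q \<in> carrier R"
    and pq: "p \<otimes> (t \<otimes> s) = q \<otimes> (t1 \<otimes> s1)"
    using Ore[of "t \<otimes> s" "t1 \<otimes> s1"] by (auto simp: mult_in_S)
  obtain u where u [simp]: "u \<in> S" and ur: "u \<otimes> (p \<otimes> t \<otimes> r) = u \<otimes> (q \<otimes> t1 \<otimes> r1)"
    using frac_eq_multipliers[OF eq, of "p \<otimes> t" "q \<otimes> t1"] pq by (auto simp: m_assoc)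
  \<comment> \<open>Since \<open>t r = a s'\<close>, equal numerators of the first factor are equal
    denominators for the second one, which is what the next application requires.\<close>
  have "u \<otimes> p \<otimes> a \<otimes> s' = u \<otimes> q \<otimes> a1 \<otimes> s1'"
    using ur by (simp add: m_assoc t(3) t1(3))
  then obtain w where w [simp]: "w \<in> S"
    and wr: "w \<otimes> (u \<otimes> p \<otimes> a \<otimes> r') = w \<otimes> (u \<otimes> q \<otimes> a1 \<otimes> r1')"
    using frac_eq_multipliers[OF eq', of "u \<otimes> p \<otimes> a" "u \<otimes> q \<otimes> a1"] by auto
  have 1: "w \<otimes> (u \<otimes> (p \<otimes> (a \<otimes> r'))) = w \<otimes> (u \<otimes> (q \<otimes> (a1 \<otimes> r1')))"
    using wr by (simp add: m_assoc)
  show ?thesis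
    by (rule frac_eqI'[where a = "u \<otimes> p" and b = "u \<otimes> q" and t = w])
      (simp_all add: m_assoc mult_in_S 1 flip: pq)
qed

lemma frac_add_cong:
  assumes eq: "(s, r) \<approx> (s1, r1)" and eq': "(s', r') \<approx> (s1', r1')"
    and ab: "a \<in> carrier R" "b \<in> carrier R" "a \<otimes> s = b \<otimes> s'" "a \<otimes> s \<in> S"
    and ab1: "a1 \<in> carrier R" "b1 \<in> carrier R" "a1 \<otimes> s1 = b1 \<otimes> s1'" "a1 \<otimes> s1 \<in> S"
  shows "(a \<otimes> s, a \<otimes> r \<oplus> b \<otimes> r') \<approx> (a1 \<otimes> s1, a1 \<otimes> r1 \<oplus> b1 \<otimes> r1')"
proof -
  have s [simp]: "s \<in> S" "s1 \<in> S" "s' \<in> S" "s1' \<in> S" 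
    and r [simp]: "r \<in> carrier R" "r1 \<in> carrier R" "r' \<in> carrier R" "r1' \<in> carrier R"
    using eq eq' unfolding frac_eq_iff by blast+
  note ab(1,2,4) [simp] ab1(1,2,4) [simp]
  obtain p q where p [simp]: "p \<in> S" "q \<in> carrier R" and pq: "p \<otimes> (a \<otimes> s) = q \<otimes> (a1 \<otimes> s1)"
    using Ore[of "a \<otimes> s" "a1 \<otimes> s1"] by auto
  obtain u where u [simp]: "u \<in> S" and ur: "u \<otimes> (p \<otimes> a \<otimes> r) = u \<otimes> (q \<otimes> a1 \<otimes> r1)"
    using frac_eq_multipliers[OF eq, of "p \<otimes> a" "q \<otimes> a1"] pq by (auto simp: m_assoc)
  have "p \<otimes> (b \<otimes> s') = q \<otimes> (b1 \<otimes> s1')"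
    using pq ab(3) ab1(3) by simp
  \<comment> \<open>The factor \<open>u\<close> found for the first summand is built into the
    multipliers of the second, so that the single factor \<open>w\<close> serves both.\<close>
  then have "u \<otimes> p \<otimes> b \<otimes> s' = u \<otimes> q \<otimes> b1 \<otimes> s1'"
    by (simp add: m_assoc)
  then obtain w where w [simp]: "w \<in> S"
    and wr: "w \<otimes> (u \<otimes> p \<otimes> b \<otimes> r') = w \<otimes> (u \<otimes> q \<otimes> b1 \<otimes> r1')"
    using frac_eq_multipliers[OF eq', of "u \<otimes> p \<otimes> b" "u \<otimes> q \<otimes> b1"] by auto
  have 1: "w \<otimes> (u \<otimes> (p \<otimes> (a \<otimes> r))) = w \<otimes> (u \<otimes> (q \<otimes> (a1 \<otimes> r1)))"
    using ur by (simp add: m_assoc)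
  have 2: "w \<otimes> (u \<otimes> (p \<otimes> (b \<otimes> r'))) = w \<otimes> (u \<otimes> (q \<otimes> (b1 \<otimes> r1')))"
    using wr by (simp add: m_assoc)
  show ?thesis
    by (rule frac_eqI'[where a = "u \<otimes> p" and b = "u \<otimes> q" and t = w])
      (simp_all add: m_assoc mult_in_S r_distr 1 2 flip: pq)
qed

section \<open>Operations of the localization computed on representatives\<close>

lemma left_frac_eq_iff:
  assumes "s \<in> S" "r \<in> carrier R" "s' \<in> S" "r' \<in> carrier R"
  shows "left_frac R S s r = left_frac R S s' r' \<longleftrightarrow> (s, r) \<approx> (s', r')"
  unfolding left_frac_def using eq_equiv_class_iff[OF frac_eq_equiv] assms by auto

lemma left_frac_eqI: "(s, r) \<approx> (s', r') \<Longrightarrow> left_frac R S s r = left_frac R S s' r'"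
  unfolding left_frac_def by (rule equiv_class_eq[OF frac_eq_equiv])

lemma mem_left_frac_iff: "(s', r') \<in> left_frac R S s r \<longleftrightarrow> (s, r) \<approx> (s', r')"
  by (simp add: left_frac_def)

lemma left_frac_expand:
  assumes "s \<in> S" "r \<in> carrier R" "u \<in> carrier R" "u \<otimes> s \<in> S"
  shows "left_frac R S (u \<otimes> s) (u \<otimes> r) = left_frac R S s r"
  using left_frac_eqI[OF frac_eq_expand[OF assms]] by simp

lemma frac_eq_refl: "s \<in> S \<Longrightarrow> r \<in> carrier R \<Longrightarrow> (s, r) \<approx> (s, r)"
  using equiv_class_self[OF frac_eq_equiv] by auto

lemma carrier_left_localization:
  "carrier (left_localization R S) = {left_frac R S s r | s r. s \<in> S \<and> r \<in> carrier R}"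
  by (auto simp: left_localization_def quotient_def left_frac_def)

text \<open>The congruence lemma shows that the family of classes united in the definition is a
  singleton, so its union is the expected class. Sum and scalar multiple are treated in the same
  way.\<close>

lemma left_localization_mult:
  assumes "s \<in> S" "r \<in> carrier R" "s' \<in> S" "r' \<in> carrier R"
    and t: "t \<in> S" "a \<in> carrier R" "t \<otimes> r = a \<otimes> s'"
  shows "left_frac R S s r \<otimes>\<^bsub>left_localization R S\<^esub> left_frac R S s' r' =
           left_frac R S (t \<otimes> s) (a \<otimes> r')"
proof -
  let ?M = "{left_frac R S (t \<otimes> s1) (a \<otimes> r1') | s1 r1 s1' r1' t a.
      (s, r) \<approx> (s1, r1) \<and> (s', r') \<approx> (s1', r1') \<and> t \<in> S \<and> a \<in> carrier R \<and> t \<otimes> r1 = a \<otimes> s1'}"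
  have "X = left_frac R S (t \<otimes> s) (a \<otimes> r')" if "X \<in> ?M" for X
    using that left_frac_eqI[OF frac_mult_cong] t by blast
  moreover have "left_frac R S (t \<otimes> s) (a \<otimes> r') \<in> ?M"
    using assms frac_eq_refl by blast
  ultimately have "?M = {left_frac R S (t \<otimes> s) (a \<otimes> r')}"
    by blast
  then show ?thesis
    by (simp add: left_localization_def mem_left_frac_iff)
qed

lemma left_localization_add:
  assumes "s \<in> S" "r \<in> carrier R" "s' \<in> S" "r' \<in> carrier R"
    and ab: "a \<in> carrier R" "b \<in> carrier R" "a \<otimes> s = b \<otimes> s'" "a \<otimes> s \<in> S"
  shows "left_frac R S s r \<oplus>\<^bsub>left_localization R S\<^esub> left_frac R S s' r' =
           left_frac R S (a \<otimes> s) (a \<otimes> r \<oplus> b \<otimes> r')"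
proof -
  let ?M = "{left_frac R S (a \<otimes> s1) (a \<otimes> r1 \<oplus> b \<otimes> r1') | s1 r1 s1' r1' a b.
      (s, r) \<approx> (s1, r1) \<and> (s', r') \<approx> (s1', r1') \<and> a \<in> carrier R \<and> b \<in> carrier R \<and>
      a \<otimes> s1 = b \<otimes> s1' \<and> a \<otimes> s1 \<in> S}"
  have "X = left_frac R S (a \<otimes> s) (a \<otimes> r \<oplus> b \<otimes> r')" if "X \<in> ?M" for X
    using that left_frac_eqI[OF frac_add_cong] ab by blast
  moreover have "left_frac R S (a \<otimes> s) (a \<otimes> r \<oplus> b \<otimes> r') \<in> ?M"
    using assms frac_eq_refl by blast
  ultimately have "?M = {left_frac R S (a \<otimes> s) (a \<otimes> r \<oplus> b \<otimes> r')}"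
    by blast
  then show ?thesis
    by (simp add: left_localization_def mem_left_frac_iff)
qed

lemma left_localization_smult:
  assumes "s \<in> S" "r \<in> carrier R"
  shows "k \<odot>\<^bsub>left_localization R S\<^esub> left_frac R S s r = left_frac R S s (k \<odot> r)"
proof -
  let ?M = "{left_frac R S s1 (k \<odot> r1) | s1 r1. (s, r) \<approx> (s1, r1)}"
  have "X = left_frac R S s (k \<odot> r)" if X_in: "X \<in> ?M" for X
  proof -
    obtain s1 r1 where X: "X = left_frac R S s1 (k \<odot> r1)" and "(s, r) \<approx> (s1, r1)"
      using X_in by blast
    then obtain a b where "s \<in> S" "r \<in> carrier R" "s1 \<in> S" "r1 \<in> carrier R"
      "a \<in> carrier R" "b \<in> carrier R" "a \<otimes> s = b \<otimes> s1" "a \<otimes> s \<in> S" "a \<otimes> r = b \<otimes> r1"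
      unfolding frac_eq_iff by blast
    then have "(s, k \<odot> r) \<approx> (s1, k \<odot> r1)"
      by (intro frac_eqI[where a = a and b = b]) (auto simp: mult_smult smult_closed)
    then show ?thesis
      unfolding X by (simp add: left_frac_eqI)
  qed
  moreover have "left_frac R S s (k \<odot> r) \<in> ?M"
    using assms frac_eq_refl by blast
  ultimately have "?M = {left_frac R S s (k \<odot> r)}"
    by blast
  then show ?thesis
    by (simp add: left_localization_def mem_left_frac_iff)
qed

end

lemma (in cancellative_left_Ore_set) left_denominator_set:
  assumes "\<zero> \<notin> S"
  shows "left_denominator_set R S"
proof -
  have "left_Ore_set R S"
    unfolding left_Ore_set_def multiplicative_set_def
  proof (intro conjI ballI)
    fix r s assume "r \<in> carrier R" "s \<in> S"
    then obtain t a where "t \<in> S" "a \<in> carrier R" "t \<otimes> r = a \<otimes> s"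
      using Ore by blast
    then have "t \<otimes> r \<in> (\<lambda>t. t \<otimes> r) ` S \<inter> (\<lambda>a. a \<otimes> s) ` carrier R"
      by (intro IntI imageI) auto
    then show "(\<lambda>t. t \<otimes> r) ` S \<inter> (\<lambda>a. a \<otimes> s) ` carrier R \<noteq> {}"
      by blast
  qed (use S_subset one_in_S mult_in_S assms in auto)
  moreover have "\<exists>t\<in>S. t \<otimes> r = \<zero>" if "r \<in> carrier R" "s \<in> S" "r \<otimes> s = \<zero>" for r s
  proof -
    \<comment> \<open>Right cancellation makes the annihilation condition trivial: the multiplier
      \<open>t\<close> can be \<open>\<one>\<close>.\<close>
    have "r = \<zero>"
      using right_cancel[of r \<zero> s] that by simp
    then show ?thesis
      by (intro bexI[OF _ one_in_S]) simp
  qed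
  ultimately show ?thesis
    by (simp only: left_denominator_set_def) simp
qed

text \<open>Every fraction on either side has a representative with denominator in
  \<open>S \<inter> B\<close> and numerator in \<open>B\<close>: by \<open>clear\<close> over
  \<open>R\<close>, by \<open>into_S\<close> over \<open>B\<close>. The isomorphism is the identity
  on such representatives. \<open>left_cancel\<close> makes it well defined, \<open>into_S\<close>
  makes it injective.\<close>

theorem left_localization_subalgebra_iso:
  fixes R :: "('k, 'a, 'm) module_scheme" (structure)
  assumes R: "cancellative_left_Ore_set R S"
    and A: "cancellative_left_Ore_set (R\<lparr>carrier := B\<rparr>) T"
    and B: "B \<subseteq> carrier R"
    and ST: "S \<inter> B \<subseteq> T"
    and clear: "\<And>s r. s \<in> S \<Longrightarrow> r \<in> carrier R \<Longrightarrow> \<exists>u\<in>carrier R. u \<otimes> s \<in> S \<inter> B \<and> u \<otimes> r \<in> B"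
    and into_S: "\<And>t. t \<in> T \<Longrightarrow> \<exists>c\<in>B. c \<otimes> t \<in> S"
    and left_cancel: "\<And>t z z'. t \<in> S \<Longrightarrow> z \<in> B \<Longrightarrow> z' \<in> B \<Longrightarrow> t \<otimes> z = t \<otimes> z' \<Longrightarrow> z = z'"
  shows "algebra_isomorphic (left_localization R S) (left_localization (R\<lparr>carrier := B\<rparr>) T)"
proof -
  let ?A = "R\<lparr>carrier := B\<rparr>"
  let ?L = "left_localization R S" and ?M = "left_localization ?A T"
  interpret R: cancellative_left_Ore_set R S by (rule R)
  interpret A: cancellative_left_Ore_set ?A T by (rule A)
  note [simp] = R.m_assoc
  have B_carrier [simp]: "b \<in> carrier R" if "b \<in> B" for b
    using B that by blast
  have B_mult [simp]: "a \<otimes> b \<in> B" if "a \<in> B" "b \<in> B" for a b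
    using A.m_closed[of a b] that by simp
  have B_add [simp]: "a \<oplus> b \<in> B" if "a \<in> B" "b \<in> B" for a b
    using A.a_closed[of a b] that by simp
  have B_smult [simp]: "k \<odot> b \<in> B" if "b \<in> B" for b k
    using A.smult_closed[of b k] that by simp
  have T_B [simp]: "t \<in> B" if "t \<in> T" for t
    using A.S_subset that by auto
  have S_T [simp]: "s \<in> T" if "s \<in> S" "s \<in> B" for s
    using ST that by blast

  have frac_iff: "left_frac R S s r = left_frac R S s' r' \<longleftrightarrow> left_frac ?A T s r = left_frac ?A T s' r'"
    if s: "s \<in> S" "s \<in> B" "s' \<in> S" "s' \<in> B" and r: "r \<in> B" "r' \<in> B" for s r s' r'
  proof
    assume "left_frac R S s r = left_frac R S s' r'"
    then have eq: "((s, r), (s', r')) \<in> left_frac_rel R S"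
      using s r by (simp add: R.left_frac_eq_iff)
    \<comment> \<open>The multipliers contained in \<open>eq\<close> may lie outside
      \<open>B\<close>. Fresh ones are taken from the Ore condition inside \<open>B\<close>; they
      equalize the numerators up to a factor \<open>t \<in> S\<close>, which
      \<open>left_cancel\<close> removes.\<close>
    obtain a b where ab: "a \<in> T" "b \<in> B" "a \<otimes> s = b \<otimes> s'"
      using A.Ore[of s s'] s by auto
    obtain t where t: "t \<in> S" "t \<otimes> (a \<otimes> r) = t \<otimes> (b \<otimes> r')"
      using R.frac_eq_multipliers[OF eq, of a b] ab by auto
    have "a \<otimes> r = b \<otimes> r'"
      using left_cancel[OF t(1) _ _ t(2)] ab r by simp
    then have "((s, r), (s', r')) \<in> left_frac_rel ?A T"
      using ab s r A.mult_in_S[of a s] by (intro A.frac_eqI[where a = a and b = b]) auto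
    then show "left_frac ?A T s r = left_frac ?A T s' r'"
      by (rule A.left_frac_eqI)
  next
    assume "left_frac ?A T s r = left_frac ?A T s' r'"
    then have "((s, r), (s', r')) \<in> left_frac_rel ?A T"
      using A.left_frac_eq_iff[of s r s' r'] s r by simp
    then obtain a b where ab: "a \<in> B" "b \<in> B" "a \<otimes> s = b \<otimes> s'" "a \<otimes> s \<in> T" "a \<otimes> r = b \<otimes> r'"
      unfolding A.frac_eq_iff by auto
    \<comment> \<open>The common denominator is only known to lie in \<open>T\<close>; the factor
      \<open>c\<close> moves it into \<open>S\<close>.\<close>
    obtain c where c: "c \<in> B" "c \<otimes> (a \<otimes> s) \<in> S"
      using into_S[OF ab(4)] by blast
    have "((s, r), (s', r')) \<in> left_frac_rel R S"
      using ab s r c by (intro R.frac_eqI[where a = "c \<otimes> a" and b = "c \<otimes> b"]) auto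
    then show "left_frac R S s r = left_frac R S s' r'"
      by (rule R.left_frac_eqI)
  qed

  have L_cases: "\<exists>s r. s \<in> S \<and> s \<in> B \<and> r \<in> B \<and> X = left_frac R S s r" if X: "X \<in> carrier ?L" for X
  proof -
    obtain s r where sr: "s \<in> S" "r \<in> carrier R" "X = left_frac R S s r"
      using X by (auto simp: R.carrier_left_localization)
    then obtain u where "u \<in> carrier R" "u \<otimes> s \<in> S" "u \<otimes> s \<in> B" "u \<otimes> r \<in> B"
      using clear by blast
    then show ?thesis
      using R.left_frac_expand[of s r u] sr by metis
  qed
  have M_cases: "\<exists>s r. s \<in> S \<and> s \<in> B \<and> r \<in> B \<and> Y = left_frac ?A T s r" if Y: "Y \<in> carrier ?M" for Y
  proof -
    obtain s r where sr: "s \<in> T" "r \<in> B" "Y = left_frac ?A T s r"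
      using Y by (auto simp: A.carrier_left_localization)
    obtain c where c: "c \<in> B" "c \<otimes> s \<in> S"
      using into_S[OF sr(1)] by blast
    have "left_frac ?A T (c \<otimes> s) (c \<otimes> r) = left_frac ?A T s r"
      using A.left_frac_expand[of s r c] sr(1,2) c by simp
    then show ?thesis
      using sr c B_mult T_B by metis
  qed

  \<comment> \<open>By \<open>frac_iff\<close>, the choice does not depend on the
    representative.\<close>
  define f where "f X = (SOME Y. \<exists>s r. s \<in> S \<and> s \<in> B \<and> r \<in> B \<and>
    X = left_frac R S s r \<and> Y = left_frac ?A T s r)" for X
  have f: "f (left_frac R S s r) = left_frac ?A T s r" if "s \<in> S" "s \<in> B" "r \<in> B" for s r
    unfolding f_def
  proof (rule some_equality)
    show "\<exists>s' r'. s' \<in> S \<and> s' \<in> B \<and> r' \<in> B \<and> left_frac R S s r = left_frac R S s' r' \<and>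
        left_frac ?A T s r = left_frac ?A T s' r'"
      using that by blast
  next
    fix Y
    assume "\<exists>s' r'. s' \<in> S \<and> s' \<in> B \<and> r' \<in> B \<and> left_frac R S s r = left_frac R S s' r' \<and>
        Y = left_frac ?A T s' r'"
    then obtain s' r' where "s' \<in> S" "s' \<in> B" "r' \<in> B" "left_frac R S s r = left_frac R S s' r'"
      "Y = left_frac ?A T s' r'"
      by blast
    then show "Y = left_frac ?A T s r"
      using frac_iff that by simp
  qed
  have L_carrier: "left_frac R S s r \<in> carrier ?L" if "s \<in> S" "r \<in> B" for s r
    unfolding R.carrier_left_localization using that B_carrier by blast
  have M_carrier: "left_frac ?A T s r \<in> carrier ?M" if "s \<in> T" "r \<in> B" for s r
    using that by (simp add: A.carrier_left_localization) blast
  have one_B: "\<one> \<in> B" and one_S: "\<one> \<in> S"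
    using A.one_closed R.one_in_S by auto

  have "f \<in> ring_hom ?L ?M"
  proof (rule ring_hom_memI)
    fix X assume "X \<in> carrier ?L"
    then show "f X \<in> carrier ?M"
      using L_cases[of X] f M_carrier by auto
  next
    fix X Y assume "X \<in> carrier ?L" "Y \<in> carrier ?L"
    then obtain s r s' r' where s: "s \<in> S" "s \<in> B" "s' \<in> S" "s' \<in> B" and r: "r \<in> B" "r' \<in> B"
      and X: "X = left_frac R S s r" and Y: "Y = left_frac R S s' r'"
      using L_cases[of X] L_cases[of Y] by blast
    note [simp] = s r
    obtain t0 a0 where t0: "t0 \<in> T" "a0 \<in> B" "t0 \<otimes> r = a0 \<otimes> s'"
      using A.Ore[of r s'] by auto
    obtain c where c: "c \<in> B" "c \<otimes> t0 \<in> S"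
      using into_S t0(1) by blast
    \<comment> \<open>The pair \<open>t0\<close>, \<open>a0\<close> is admissible over
      \<open>B\<close> only. Multiplied by \<open>c\<close>, it computes the product in both
      localizations at once.\<close>
    define t a where "t = c \<otimes> t0" and "a = c \<otimes> a0"
    have t [simp]: "t \<in> S" "t \<in> B" "a \<in> B" and ta: "t \<otimes> r = a \<otimes> s'"
      using t0 c by (simp_all add: t_def a_def)
    have "f (X \<otimes>\<^bsub>?L\<^esub> Y) = f (left_frac R S (t \<otimes> s) (a \<otimes> r'))"
      unfolding X Y by (subst R.left_localization_mult[where t = t and a = a]) (use ta in simp_all)
    also have "\<dots> = left_frac ?A T (t \<otimes> s) (a \<otimes> r')"
      by (rule f) (auto simp: R.mult_in_S)
    also have "\<dots> = f X \<otimes>\<^bsub>?M\<^esub> f Y"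
      using A.left_localization_mult[of s r s' r' t a] ta by (simp add: X Y f)
    finally show "f (X \<otimes>\<^bsub>?L\<^esub> Y) = f X \<otimes>\<^bsub>?M\<^esub> f Y" .
    obtain b0 d0 where b0: "b0 \<in> T" "d0 \<in> B" "b0 \<otimes> s = d0 \<otimes> s'"
      using A.Ore[of s s'] by auto
    obtain e where e: "e \<in> B" "e \<otimes> b0 \<in> S"
      using into_S b0(1) by blast
    define b d where "b = e \<otimes> b0" and "d = e \<otimes> d0"
    have b [simp]: "b \<in> S" "b \<in> B" "d \<in> B" and bd: "b \<otimes> s = d \<otimes> s'"
      using b0 e by (simp_all add: b_def d_def)
    have bs [simp]: "b \<otimes> s \<in> S"
      by (simp add: R.mult_in_S)
    have "f (X \<oplus>\<^bsub>?L\<^esub> Y) = f (left_frac R S (b \<otimes> s) (b \<otimes> r \<oplus> d \<otimes> r'))"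
      unfolding X Y by (subst R.left_localization_add[where a = b and b = d]) (use bd bs in simp_all)
    also have "\<dots> = left_frac ?A T (b \<otimes> s) (b \<otimes> r \<oplus> d \<otimes> r')"
      by (rule f) auto
    also have "\<dots> = f X \<oplus>\<^bsub>?M\<^esub> f Y"
      using A.left_localization_add[of s r s' r' b d] bd S_T[OF bs] by (simp add: X Y f)
    finally show "f (X \<oplus>\<^bsub>?L\<^esub> Y) = f X \<oplus>\<^bsub>?M\<^esub> f Y" .
  next
    have "\<one>\<^bsub>?L\<^esub> = left_frac R S \<one> \<one>" "\<one>\<^bsub>?M\<^esub> = left_frac ?A T \<one> \<one>"
      by (simp_all add: left_localization_def)
    then show "f \<one>\<^bsub>?L\<^esub> = \<one>\<^bsub>?M\<^esub>"
      using f one_B one_S by simp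
  qed
  moreover have "bij_betw f (carrier ?L) (carrier ?M)"
  proof (rule bij_betw_imageI)
    show "inj_on f (carrier ?L)"
    proof (rule inj_onI)
      fix X Y assume "X \<in> carrier ?L" "Y \<in> carrier ?L" and eq: "f X = f Y"
      then obtain s r s' r' where "s \<in> S" "s \<in> B" "s' \<in> S" "s' \<in> B" "r \<in> B" "r' \<in> B"
        "X = left_frac R S s r" "Y = left_frac R S s' r'"
        using L_cases by blast
      then show "X = Y"
        using eq f frac_iff by simp
    qed
    show "f ` carrier ?L = carrier ?M"
    proof
      show "f ` carrier ?L \<subseteq> carrier ?M"
        using L_cases f M_carrier by fastforce
      show "carrier ?M \<subseteq> f ` carrier ?L"
      proof
        fix Y assume "Y \<in> carrier ?M"
        then obtain s r where "s \<in> S" "s \<in> B" "r \<in> B" "Y = left_frac ?A T s r"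
          using M_cases by blast
        then show "Y \<in> f ` carrier ?L"
          using f L_carrier by (intro image_eqI[of _ _ "left_frac R S s r"]) simp_all
      qed
    qed
  qed
  moreover have "f (k \<odot>\<^bsub>?L\<^esub> X) = k \<odot>\<^bsub>?M\<^esub> f X" if X: "X \<in> carrier ?L" for k X
  proof -
    obtain s r where sr: "s \<in> S" "s \<in> B" "r \<in> B" "X = left_frac R S s r"
      using L_cases[OF X] by blast
    then show ?thesis
      using A.left_localization_smult[of s r k] by (simp add: f R.left_localization_smult)
  qed
  ultimately show ?thesis
    unfolding algebra_isomorphic_def ring_iso_def by blast
qed

section \<open>The Weyl algebra as a left Ore domain\<close>

lemma linear_smult_iff:
  "Vector_Spaces.linear Polynomial.smult Polynomial.smult (f :: 'k::field poly \<Rightarrow> 'k poly) \<longleftrightarrow>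
     (\<forall>p q. f (p + q) = f p + f q) \<and> (\<forall>c p. f (Polynomial.smult c p) = Polynomial.smult c (f p))"
  by (simp add: Vector_Spaces.linear_iff vector_space_def smult_add_right smult_add_left)

lemma End_poly_simps [simp]:
  "(f \<in> carrier End_poly) =
     Vector_Spaces.linear Polynomial.smult Polynomial.smult (f :: 'k::field poly \<Rightarrow> 'k poly)"
  "monoid.mult End_poly = (\<lambda>f g :: 'k poly \<Rightarrow> 'k poly. f \<circ> g)"
  "one End_poly = (id :: 'k poly \<Rightarrow> 'k poly)"
  "zero End_poly = (\<lambda>p :: 'k poly. 0)"
  "add End_poly = (\<lambda>(f :: 'k poly \<Rightarrow> 'k poly) g p. f p + g p)"
  "module.smult End_poly = (\<lambda>k (f :: 'k poly \<Rightarrow> 'k poly) p. Polynomial.smult k (f p))"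
  by (simp_all add: End_poly_def)

lemma ring_End_poly: "ring (End_poly :: ('k::field, 'k poly \<Rightarrow> 'k poly) module)"
proof (rule ringI)
  show "abelian_group (End_poly :: ('k::field, 'k poly \<Rightarrow> 'k poly) module)"
  proof (rule abelian_groupI)
    fix f :: "'k poly \<Rightarrow> 'k poly" assume f: "f \<in> carrier End_poly"
    show "\<exists>g\<in>carrier End_poly. g \<oplus>\<^bsub>End_poly\<^esub> f = \<zero>\<^bsub>End_poly\<^esub>"
      by (rule bexI[of _ "\<lambda>p. - f p"]) (use f in \<open>auto simp: linear_smult_iff\<close>)
  qed (auto simp: linear_smult_iff algebra_simps smult_add_right)
  show "Group.monoid (End_poly :: ('k::field, 'k poly \<Rightarrow> 'k poly) module)"
    by (rule monoidI) (auto simp: linear_smult_iff)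
qed (auto simp: linear_smult_iff)

interpretation End_poly: ring "End_poly :: ('k::field, 'k poly \<Rightarrow> 'k poly) module"
  by (rule ring_End_poly)

lemma a_inv_End_poly:
  fixes f :: "'k::field poly \<Rightarrow> 'k poly"
  assumes "f \<in> carrier End_poly"
  shows "\<ominus>\<^bsub>End_poly\<^esub> f = (\<lambda>p. - f p)"
  by (rule End_poly.minus_equality) (use assms in \<open>auto simp: linear_smult_iff\<close>)

section \<open>Closure properties and induction for the Weyl algebra\<close>

abbreviation Weyl_ops :: "('k::field poly \<Rightarrow> 'k poly) set" where
  "Weyl_ops \<equiv> carrier Weyl_algebra"

lemma linear_mult_X: "mult_X \<in> carrier End_poly"
  and linear_pderiv: "pderiv \<in> carrier End_poly"
  and linear_scalar: "Polynomial.smult k \<in> carrier End_poly"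
  by (auto simp: linear_smult_iff mult_X_def pderiv_add pderiv_smult smult_add_right algebra_simps)

lemma carrier_Weyl_algebra:
  "Weyl_ops = generate_ring End_poly ({mult_X, pderiv} \<union> range Polynomial.smult)"
  by (simp add: Weyl_algebra_def generate_algebra_def)

lemma Weyl_generators_carrier: "{mult_X, pderiv} \<union> range Polynomial.smult \<subseteq> carrier End_poly"
  using linear_mult_X linear_pderiv linear_scalar by blast

lemma Weyl_linear: "f \<in> Weyl_ops \<Longrightarrow> Vector_Spaces.linear Polynomial.smult Polynomial.smult f"
  using End_poly.generate_ring_in_carrier[OF Weyl_generators_carrier] End_poly_simps(1)
  unfolding carrier_Weyl_algebra by blast

lemma mult_X_in_Weyl: "mult_X \<in> Weyl_ops"
  and pderiv_in_Weyl: "pderiv \<in> Weyl_ops"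
  and scalar_in_Weyl: "Polynomial.smult k \<in> Weyl_ops"
  unfolding carrier_Weyl_algebra by (auto intro!: generate_ring.incl)

lemma id_in_Weyl: "id \<in> Weyl_ops"
  using generate_ring.one[of End_poly] by (simp add: carrier_Weyl_algebra)

lemma comp_in_Weyl: "f \<in> Weyl_ops \<Longrightarrow> g \<in> Weyl_ops \<Longrightarrow> f \<circ> g \<in> Weyl_ops"
  using generate_ring.eng_mult[of f End_poly _ g] by (simp add: carrier_Weyl_algebra)

lemma add_in_Weyl: "f \<in> Weyl_ops \<Longrightarrow> g \<in> Weyl_ops \<Longrightarrow> (\<lambda>p. f p + g p) \<in> Weyl_ops"
  using generate_ring.eng_add[of f End_poly _ g] by (simp add: carrier_Weyl_algebra)

lemma smult_in_Weyl: "f \<in> Weyl_ops \<Longrightarrow> (\<lambda>p. Polynomial.smult k (f p)) \<in> Weyl_ops"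
  using comp_in_Weyl[OF scalar_in_Weyl, of f k] by (simp add: comp_def)

lemma zero_in_Weyl: "(\<lambda>p. 0 :: 'k::field poly) \<in> Weyl_ops"
proof -
  have "Polynomial.smult 0 = (\<lambda>p. 0 :: 'k poly)" by (simp add: fun_eq_iff)
  then show ?thesis using scalar_in_Weyl[of 0] by metis
qed

lemma minus_in_Weyl: "f \<in> Weyl_ops \<Longrightarrow> (\<lambda>p. - f p) \<in> Weyl_ops"
  using smult_in_Weyl[of f "-1"] by simp

lemma pderiv_power_in_Weyl: "pderiv ^^ n \<in> Weyl_ops"
proof (induction n)
  case 0
  then show ?case using id_in_Weyl by (simp only: funpow.simps)
next
  case (Suc n)
  then show ?case using comp_in_Weyl[OF pderiv_in_Weyl] by (simp only: funpow.simps)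
qed

lemma mult_monom_in_Weyl: "(\<lambda>p. monom 1 n * p) \<in> Weyl_ops"
proof (induction n)
  case 0
  then show ?case using id_in_Weyl by (simp add: id_def monom_0 flip: one_pCons)
next
  case (Suc n)
  have "(\<lambda>p. monom 1 (Suc n) * p) = mult_X \<circ> (\<lambda>p. monom 1 n * p)"
    by (auto simp: fun_eq_iff mult_X_def monom_Suc)
  then show ?case using Suc comp_in_Weyl[OF mult_X_in_Weyl] by metis
qed

text \<open>The cases for the unit and for additive inverses disappear, because they are covered by
  the scalars \<open>1\<close> and \<open>-1\<close>.\<close>

lemma Weyl_induct [consumes 1, case_names mult_X pderiv scalar add comp]:
  fixes f :: "'k::field poly \<Rightarrow> 'k poly"
  assumes f: "f \<in> Weyl_ops"
    and gens: "P mult_X" "P pderiv" "\<And>k. P (Polynomial.smult k)"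
    and add: "\<And>f g. f \<in> Weyl_ops \<Longrightarrow> g \<in> Weyl_ops \<Longrightarrow> P f \<Longrightarrow> P g \<Longrightarrow> P (\<lambda>p. f p + g p)"
    and comp: "\<And>f g. f \<in> Weyl_ops \<Longrightarrow> g \<in> Weyl_ops \<Longrightarrow> P f \<Longrightarrow> P g \<Longrightarrow> P (f \<circ> g)"
  shows "P f"
  using f unfolding carrier_Weyl_algebra
proof (induction rule: generate_ring.induct)
  case one
  have "Polynomial.smult 1 = (id :: 'k poly \<Rightarrow> 'k poly)" by (simp add: fun_eq_iff)
  then show ?case using gens(3)[of 1] by (simp only: End_poly_simps)
next
  case (incl h)
  then show ?case using gens by auto
next
  case (a_inv h)
  then have "h \<in> Weyl_ops" by (simp add: carrier_Weyl_algebra)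
  moreover have "\<ominus>\<^bsub>End_poly\<^esub> h = Polynomial.smult (-1) \<circ> h"
    using Weyl_linear[OF \<open>h \<in> Weyl_ops\<close>] by (simp add: a_inv_End_poly fun_eq_iff)
  ultimately show ?case using comp[OF scalar_in_Weyl _ gens(3)] a_inv.IH by metis
next
  case (eng_add f g)
  then show ?case using add[of f g] by (simp add: carrier_Weyl_algebra)
next
  case (eng_mult f g)
  then show ?case using comp[of f g] by (simp only: End_poly_simps carrier_Weyl_algebra)
qed

section \<open>Action on monomials, orders of vanishing at 0 and the domain property\<close>

lemma linear_as_sum:
  assumes "Vector_Spaces.linear Polynomial.smult Polynomial.smult f"
  shows "f p = (\<Sum>k\<le>degree p. Polynomial.smult (coeff p k) (f (monom 1 k)))"
proof -
  interpret Vector_Spaces.linear Polynomial.smult Polynomial.smult f by fact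
  have "f p = f (\<Sum>k\<le>degree p. monom (coeff p k) k)"
    by (simp add: poly_as_sum_of_monoms)
  also have "\<dots> = (\<Sum>k\<le>degree p. f (Polynomial.smult (coeff p k) (monom 1 k)))"
    by (simp add: sum smult_monom)
  finally show ?thesis
    by (simp add: scale)
qed

lemma linear_zero_iff:
  assumes "Vector_Spaces.linear Polynomial.smult Polynomial.smult f"
  shows "f = (\<lambda>p. 0) \<longleftrightarrow> (\<forall>k. f (monom 1 k) = 0)"
proof
  assume "\<forall>k. f (monom 1 k) = 0"
  then have "f p = 0" for p
    by (subst linear_as_sum[OF assms]) simp
  then show "f = (\<lambda>p. 0)"
    by (simp add: fun_eq_iff)
qed simp

text \<open>The relation \<open>x\<^sup>N f(x\<^sup>k) = \<Sum>\<^sub>j P\<^sub>j(k) x\<^sup>k\<^sup>+\<^sup>j\<close>; multiplying by \<open>x\<^sup>N\<close> avoids negative shifts.\<close>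

definition shift_form :: "('k::field poly \<Rightarrow> 'k poly) \<Rightarrow> nat \<Rightarrow> (nat \<Rightarrow> 'k poly) \<Rightarrow> bool" where
  "shift_form f N P \<longleftrightarrow> (\<forall>k n. coeff (monom 1 N * f (monom 1 k)) n =
     (if k \<le> n then poly (P (n - k)) (of_nat k) else 0))"

text \<open>Used to give two operators the same exponent \<open>N\<close> before their forms are
  added.\<close>

lemma shift_form_raise:
  assumes "shift_form f N P"
  shows "shift_form f (M + N) (\<lambda>j. if j < M then 0 else P (j - M))"
  unfolding shift_form_def
proof (intro allI)
  fix k n
  have "coeff (monom 1 (M + N) * f (monom 1 k)) n =
      coeff (monom 1 M * (monom 1 N * f (monom 1 k))) n"
    by (simp add: mult_monom flip: mult.assoc)
  also have "\<dots> = (if n < M then 0 else coeff (monom 1 N * f (monom 1 k)) (n - M))"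
    by (simp add: coeff_monom_mult)
  also have "\<dots> = (if k \<le> n then poly (if n - k < M then 0 else P (n - k - M)) (of_nat k) else 0)"
    using assms by (auto simp: shift_form_def add.commute)
  finally show "coeff (monom 1 (M + N) * f (monom 1 k)) n =
    (if k \<le> n then poly (if n - k < M then 0 else P (n - k - M)) (of_nat k) else 0)" .
qed

lemma shift_form_add:
  assumes "shift_form f N P" "shift_form g N Q"
  shows "shift_form (\<lambda>p. f p + g p) N (\<lambda>j. P j + Q j)"
  using assms by (auto simp: shift_form_def distrib_left)

lemma shift_form_mult_X:
  assumes "shift_form f N P"
  shows "shift_form (mult_X \<circ> f) N (\<lambda>j. if j < 1 then 0 else P (j - 1))"
proof -
  have "monom 1 N * mult_X (f (monom 1 k)) = monom 1 (1 + N) * f (monom 1 k)" for k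
    by (simp add: mult_X_def monom_Suc)
  then show ?thesis
    using shift_form_raise[OF assms, of 1] unfolding shift_form_def by simp
qed

text \<open>Coefficient \<open>n\<close> of \<open>x^(N+1) g'\<close> is \<open>n - N\<close> times
  coefficient \<open>n\<close> of \<open>x^N g\<close>. With \<open>n = k + j\<close> this factor is
  the linear polynomial \<open>k + (j - N)\<close> in \<open>k\<close>; it vanishes at
  \<open>n = N\<close>, where the constant term of \<open>g\<close> is lost.\<close>

lemma shift_form_pderiv:
  fixes f :: "'k::field poly \<Rightarrow> 'k poly"
  assumes "shift_form f N P"
  shows "shift_form (pderiv \<circ> f) (Suc N) (\<lambda>j. [:of_nat j - of_nat N, 1:] * P j)"
  unfolding shift_form_def
proof (intro allI)
  fix k n
  have "coeff (monom 1 (Suc N) * pderiv (f (monom 1 k))) n =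
      (of_nat n - of_nat N) * coeff (monom 1 N * f (monom 1 k)) n"
    by (cases "n \<le> N") (auto simp: coeff_monom_mult coeff_pderiv not_le Suc_diff_Suc of_nat_diff)
  also have "\<dots> = (if k \<le> n then poly ([:of_nat (n - k) - of_nat N, 1:] * P (n - k)) (of_nat k) else 0)"
    using assms by (auto simp: shift_form_def of_nat_diff algebra_simps)
  finally show "coeff (monom 1 (Suc N) * (pderiv \<circ> f) (monom 1 k)) n =
    (if k \<le> n then poly ([:of_nat (n - k) - of_nat N, 1:] * P (n - k)) (of_nat k) else 0)"
    by simp
qed

lemma Weyl_shift_form:
  assumes "f \<in> Weyl_ops"
  shows "\<exists>N P. shift_form f N P"
proof -
  \<comment> \<open>Letting the generators act on an arbitrary \<open>g\<close> with a shift form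
    reduces the composition case to associativity.\<close>
  have "\<forall>g. (\<exists>N P. shift_form g N P) \<longrightarrow> (\<exists>N P. shift_form (f \<circ> g) N P)"
    using assms
  proof (induction rule: Weyl_induct)
    case mult_X
    then show ?case using shift_form_mult_X by blast
  next
    case pderiv
    then show ?case using shift_form_pderiv by blast
  next
    case (scalar c)
    have "shift_form (Polynomial.smult c \<circ> g) N (\<lambda>j. Polynomial.smult c (P j))"
      if "shift_form g N P" for g :: "'a poly \<Rightarrow> 'a poly" and N P
      using that by (auto simp: shift_form_def)
    then show ?case by blast
  next
    case (add f h)
    show ?case
    proof (intro allI impI)
      fix g :: "'a poly \<Rightarrow> 'a poly" assume "\<exists>N P. shift_form g N P"
      then obtain N P M Q where "shift_form (f \<circ> g) N P" "shift_form (h \<circ> g) M Q"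
        using add.IH by blast
      from shift_form_add[OF shift_form_raise[OF this(1), of M]
          shift_form_raise[OF this(2), of N, unfolded add.commute[of N]]]
      show "\<exists>N P. shift_form ((\<lambda>p. f p + h p) \<circ> g) N P"
        by (auto simp: comp_def)
    qed
  next
    case (comp f h)
    then show ?case by (metis comp_assoc)
  qed
  moreover have "shift_form id 0 (\<lambda>j. if j = 0 then 1 else 0)"
    by (auto simp: shift_form_def monom_0 simp flip: one_pCons)
  ultimately show ?thesis by (metis comp_id)
qed

text \<open>The exact order of vanishing at 0, as a relation so that the zero polynomial has no
  order.\<close>

definition has_order :: "nat \<Rightarrow> 'k::zero poly \<Rightarrow> bool" where
  "has_order n p \<longleftrightarrow> coeff p n \<noteq> 0 \<and> (\<forall>i<n. coeff p i = 0)"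

lemma has_order_nonzero: "has_order n p \<Longrightarrow> p \<noteq> 0"
  by (auto simp: has_order_def)

lemma has_order_monom: "has_order n (monom (1::'k::zero_neq_one) n)"
  by (simp add: has_order_def)

lemma eventually_poly_of_nat_nonzero:
  fixes p :: "'k::field_char_0 poly"
  assumes "p \<noteq> 0"
  shows "\<exists>K. \<forall>k\<ge>K. poly p (of_nat k) \<noteq> 0"
proof -
  have "finite ((of_nat :: nat \<Rightarrow> 'k) -` {x. poly p x = 0})"
    by (rule finite_vimageI[OF poly_roots_finite[OF assms] inj_of_nat])
  then obtain K where "\<forall>k\<in>(of_nat :: nat \<Rightarrow> 'k) -` {x. poly p x = 0}. k < K"
    unfolding finite_nat_set_iff_bounded by blast
  then have "poly p (of_nat k) \<noteq> 0" if "K \<le> k" for k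
    using that by (auto dest: bspec[of _ _ k])
  then show ?thesis by blast
qed

text \<open>Only the lowest homogeneous component of \<open>f\<close> contributes to the lowest term of \<open>f q\<close>.\<close>

lemma Weyl_order:
  fixes f :: "'k::field_char_0 poly \<Rightarrow> 'k poly"
  assumes f: "f \<in> Weyl_ops" "f \<noteq> (\<lambda>p. 0)"
  shows "\<exists>a b. \<forall>m q. has_order (m + b) q \<longrightarrow> has_order (m + a) (f q)"
proof -
  note lin = Weyl_linear[OF f(1)]
  obtain N P where P: "shift_form f N P"
    using Weyl_shift_form[OF f(1)] by blast
  have "\<exists>j. P j \<noteq> 0"
  proof (rule ccontr)
    assume "\<not> ?thesis"
    then have "monom 1 N * f (monom 1 k) = 0" for k
      using P unfolding shift_form_def by (intro poly_eqI) auto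
    then have "f (monom 1 k) = 0" for k
      by (simp add: monom_eq_0_iff)
    then show False
      using f(2) linear_zero_iff[OF lin] by blast
  qed
  \<comment> \<open>The lowest homogeneous component of \<open>f\<close> sends \<open>x^k\<close> to
    \<open>P l (k) x^(k + l - N)\<close>.\<close>
  define l where "l = (LEAST j. P j \<noteq> 0)"
  have l: "P l \<noteq> 0"
    unfolding l_def using \<open>\<exists>j. P j \<noteq> 0\<close> by (rule LeastI_ex)
  have below_l: "P j = 0" if "j < l" for j
    using not_less_Least[of j] that unfolding l_def by blast
  obtain K where K: "\<And>k. k \<ge> K \<Longrightarrow> poly (P l) (of_nat k) \<noteq> 0"
    using eventually_poly_of_nat_nonzero[OF l] by blast
  \<comment> \<open>The summand \<open>K\<close> keeps \<open>P l\<close> away from its roots; the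
    summand \<open>N\<close> absorbs the negative shift, so that order \<open>m + K + N\<close> goes
    to \<open>m + K + l\<close>.\<close>
  define b where "b = K + N"
  have "has_order (m + (K + l)) (f q)" if q: "has_order (m + b) q" for m q
  proof -
    let ?d = "m + b"
    have coeff_f: "coeff (f q) i = (\<Sum>k\<le>degree q. coeff q k *
        (if k \<le> i + N then poly (P (i + N - k)) (of_nat k) else 0))" for i
    proof -
      have "coeff (f (monom 1 k)) i = coeff (monom 1 N * f (monom 1 k)) (i + N)" for k
        by (simp add: coeff_monom_mult)
      then show ?thesis
        using P by (subst linear_as_sum[OF lin]) (simp add: coeff_sum shift_form_def)
    qed
    have "coeff (f q) i = 0" if "i < m + (K + l)" for i
      unfolding coeff_f
    proof (rule sum.neutral, rule ballI)
      fix k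
      have "k < ?d \<or> i + N - k < l \<or> k > i + N"
        using that by (auto simp: b_def)
      then show "coeff q k * (if k \<le> i + N then poly (P (i + N - k)) (of_nat k) else 0) = 0"
        using q below_l by (auto simp: has_order_def)
    qed
    moreover have "coeff (f q) (m + (K + l)) = coeff q ?d * poly (P l) (of_nat ?d)"
    proof -
      have "?d \<le> degree q"
        using q by (intro le_degree) (simp add: has_order_def)
      moreover have "coeff q k * (if k \<le> m + (K + l) + N then poly (P (m + (K + l) + N - k)) (of_nat k) else 0) = 0"
        if "k \<noteq> ?d" for k
      proof -
        have "k < ?d \<or> m + (K + l) + N - k < l \<or> k > m + (K + l) + N"
          using that by (auto simp: b_def)
        then show ?thesis
          using q below_l by (auto simp: has_order_def)
      qed
      ultimately have "coeff (f q) (m + (K + l)) = (\<Sum>k\<in>{?d}. coeff q k *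
          (if k \<le> m + (K + l) + N then poly (P (m + (K + l) + N - k)) (of_nat k) else 0))"
        unfolding coeff_f by (intro sum.mono_neutral_right) auto
      then show ?thesis
        by (simp add: b_def ac_simps)
    qed
    moreover have "poly (P l) (of_nat ?d) \<noteq> 0"
      by (rule K) (simp add: b_def)
    ultimately show ?thesis
      using q by (simp add: has_order_def)
  qed
  then show ?thesis by blast
qed

text \<open>Both operators shift orders of vanishing once the order is large. Starting with
  \<open>x^(b + d)\<close> is enough for both: \<open>g\<close> gives order \<open>b + c\<close>,
  then \<open>f\<close> gives \<open>c + a\<close>, so the composite is nonzero there.\<close>

lemma Weyl_domain:
  fixes f g :: "'k::field_char_0 poly \<Rightarrow> 'k poly"
  assumes "f \<in> Weyl_ops" "g \<in> Weyl_ops" "f \<circ> g = (\<lambda>p. 0)"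
  shows "f = (\<lambda>p. 0) \<or> g = (\<lambda>p. 0)"
proof (rule ccontr)
  assume "\<not> ?thesis"
  then obtain a b c d
    where f: "\<And>m q. has_order (m + b) q \<Longrightarrow> has_order (m + a) (f q)"
      and g: "\<And>m q. has_order (m + d) q \<Longrightarrow> has_order (m + c) (g q)"
    using Weyl_order[OF assms(1)] Weyl_order[OF assms(2)] by metis
  have "has_order (b + c) (g (monom 1 (b + d)))"
    by (rule g[OF has_order_monom])
  then have "has_order (c + a) (f (g (monom 1 (b + d))))"
    by (intro f) (simp add: add.commute)
  then show False
    using assms(3) has_order_nonzero by (metis comp_apply)
qed

text \<open>In characteristic zero, differentiation lowers a positive order by exactly one.\<close>

lemma has_order_pderiv_power:
  fixes q :: "'k::field_char_0 poly"
  shows "has_order (m + a) q \<Longrightarrow> has_order m ((pderiv ^^ a) q)"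
proof (induction a arbitrary: m)
  case (Suc a)
  then have "has_order (Suc m) ((pderiv ^^ a) q)"
    by simp
  then show ?case
    by (auto simp: has_order_def coeff_pderiv simp del: of_nat_Suc)
qed simp

section \<open>Growth of dimensions and the left Ore condition\<close>

lemma homogeneous_system_nontrivial_solution:
  fixes M :: "'i \<Rightarrow> 'j \<Rightarrow> 'k::field"
  assumes "finite J" "finite I" "card J < card I"
  shows "\<exists>c. (\<exists>i\<in>I. c i \<noteq> 0) \<and> (\<forall>j\<in>J. (\<Sum>i\<in>I. c i * M i j) = 0)"
  using assms
proof (induction J arbitrary: I M rule: finite_induct)
  case empty
  then show ?case
    by (intro exI[of _ "\<lambda>_. 1"]) (auto simp: card_gt_0_iff)
next
  case (insert j J)
  show ?case
  proof (cases "\<forall>i\<in>I. M i j = 0")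
    case True
    have "card J < card I"
      using insert by simp
    then obtain c where "\<exists>i\<in>I. c i \<noteq> 0" "\<forall>j\<in>J. (\<Sum>i\<in>I. c i * M i j) = 0"
      using insert.IH[OF insert.prems(1)] by blast
    then show ?thesis
      using True by (intro exI[of _ c]) simp
  next
    case False
    then obtain i0 where i0: "i0 \<in> I" "M i0 j \<noteq> 0"
      by blast
    \<comment> \<open>Gaussian elimination: equation \<open>j\<close> with pivot \<open>i0\<close>
      removes one unknown along with one equation.\<close>
    define M' where "M' i l = M i l - M i j / M i0 j * M i0 l" for i l
    let ?I = "I - {i0}"
    have "card J < card ?I"
      using insert i0 by simp
    then obtain c where c: "\<exists>i\<in>?I. c i \<noteq> 0" "\<forall>l\<in>J. (\<Sum>i\<in>?I. c i * M' i l) = 0"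
      using insert.IH[of ?I M'] insert.prems(1) by blast
    define s where "s = (\<Sum>i\<in>?I. c i * (M i j / M i0 j))"
    \<comment> \<open>Back substitution: this value at \<open>i0\<close> is the one that equation
      \<open>j\<close> dictates.\<close>
    define c' where "c' = c(i0 := - s)"
    have split: "(\<Sum>i\<in>I. c' i * M i l) = (\<Sum>i\<in>?I. c i * M' i l)" for l
    proof -
      have "(\<Sum>i\<in>I. c' i * M i l) = c' i0 * M i0 l + (\<Sum>i\<in>?I. c' i * M i l)"
        using insert.prems(1) i0(1) by (rule sum.remove)
      also have "(\<Sum>i\<in>?I. c' i * M i l) = (\<Sum>i\<in>?I. c i * M i l)"
        by (rule sum.cong) (auto simp: c'_def)
      also have "c' i0 * M i0 l = - (\<Sum>i\<in>?I. c i * (M i j / M i0 j) * M i0 l)"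
        by (simp add: c'_def s_def sum_distrib_right)
      finally show ?thesis
        by (simp add: M'_def right_diff_distrib sum_subtractf mult.assoc)
    qed
    have "M' i j = 0" for i
      using i0(2) by (simp add: M'_def)
    then have "\<forall>l\<in>insert j J. (\<Sum>i\<in>I. c' i * M i l) = 0"
      using c(2) by (simp add: split)
    moreover have "\<exists>i\<in>I. c' i \<noteq> 0"
      using c(1) by (auto simp: c'_def)
    ultimately show ?thesis by blast
  qed
qed

definition weyl_monom :: "nat \<times> nat \<Rightarrow> 'k::field poly \<Rightarrow> 'k poly" where
  "weyl_monom z p = monom 1 (fst z) * (pderiv ^^ snd z) p"

definition weyl_comb :: "(nat \<times> nat) set \<Rightarrow> (nat \<times> nat \<Rightarrow> 'k) \<Rightarrow> 'k::field poly \<Rightarrow> 'k poly" where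
  "weyl_comb Z c p = (\<Sum>z\<in>Z. Polynomial.smult (c z) (weyl_monom z p))"

text \<open>The two exponents are bounded separately rather than by total degree, so the index set
  is a square whose cardinality is immediate.\<close>

definition weyl_span :: "nat \<Rightarrow> ('k::field poly \<Rightarrow> 'k poly) set" where
  "weyl_span n = range (weyl_comb ({..n} \<times> {..n}))"

lemma weyl_monom_in_Weyl: "weyl_monom z \<in> Weyl_ops"
  using comp_in_Weyl[OF mult_monom_in_Weyl[of "fst z"] pderiv_power_in_Weyl[of "snd z"]]
  by (simp add: weyl_monom_def[abs_def] comp_def)

lemma sum_in_Weyl:
  assumes "\<And>z. z \<in> Z \<Longrightarrow> f z \<in> Weyl_ops"
  shows "(\<lambda>p. \<Sum>z\<in>Z. f z p) \<in> Weyl_ops"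
  using assms
proof (induction Z rule: infinite_finite_induct)
  case (insert z Z)
  then show ?case using add_in_Weyl[of "f z"] by simp
qed (simp_all add: zero_in_Weyl)

lemma weyl_comb_in_Weyl: "weyl_comb Z c \<in> Weyl_ops"
  unfolding weyl_comb_def[abs_def] by (intro sum_in_Weyl smult_in_Weyl weyl_monom_in_Weyl)

lemma weyl_span_zero: "(\<lambda>p. 0) \<in> weyl_span n"
  unfolding weyl_span_def by (rule image_eqI[of _ _ "\<lambda>_. 0"]) (auto simp: weyl_comb_def fun_eq_iff)

lemma weyl_span_add: "f \<in> weyl_span n \<Longrightarrow> g \<in> weyl_span n \<Longrightarrow> (\<lambda>p. f p + g p) \<in> weyl_span n"
  unfolding weyl_span_def
proof (elim imageE)
  fix c d assume "f = weyl_comb ({..n} \<times> {..n}) c" "g = weyl_comb ({..n} \<times> {..n}) d"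
  then show "(\<lambda>p. f p + g p) \<in> range (weyl_comb ({..n} \<times> {..n}))"
    by (intro image_eqI[of _ _ "\<lambda>z. c z + d z"])
      (auto simp: weyl_comb_def fun_eq_iff smult_add_left sum.distrib)
qed

lemma smult_sum_right: "Polynomial.smult k (\<Sum>z\<in>Z. g z) = (\<Sum>z\<in>Z. Polynomial.smult k (g z))"
  by (induction Z rule: infinite_finite_induct) (auto simp: smult_add_right)

lemma weyl_span_smult: "f \<in> weyl_span n \<Longrightarrow> (\<lambda>p. Polynomial.smult k (f p)) \<in> weyl_span n"
  unfolding weyl_span_def
proof (elim imageE)
  fix c assume "f = weyl_comb ({..n} \<times> {..n}) c"
  then show "(\<lambda>p. Polynomial.smult k (f p)) \<in> range (weyl_comb ({..n} \<times> {..n}))"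
    by (intro image_eqI[of _ _ "\<lambda>z. k * c z"]) (auto simp: weyl_comb_def fun_eq_iff smult_sum_right)
qed

lemma weyl_span_sum:
  assumes "\<And>z. z \<in> Z \<Longrightarrow> f z \<in> weyl_span n"
  shows "(\<lambda>p. \<Sum>z\<in>Z. f z p) \<in> weyl_span n"
  using assms
proof (induction Z rule: infinite_finite_induct)
  case (insert z Z)
  then show ?case using weyl_span_add[of "f z"] by simp
qed (simp_all add: weyl_span_zero)

lemma weyl_monom_in_span: "z \<in> {..n} \<times> {..n} \<Longrightarrow> weyl_monom z \<in> weyl_span n"
proof -
  assume z: "z \<in> {..n} \<times> {..n}"
  have "weyl_comb ({..n} \<times> {..n}) (\<lambda>w. if w = z then 1 else 0) p = weyl_monom z p"
    for p :: "'a poly"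
  proof -
    have "weyl_comb ({..n} \<times> {..n}) (\<lambda>w. if w = z then 1 else 0) p =
        (\<Sum>w\<in>{..n} \<times> {..n}. if w = z then weyl_monom w p else 0)"
      unfolding weyl_comb_def by (rule sum.cong) auto
    then show ?thesis using z by simp
  qed
  then show ?thesis
    unfolding weyl_span_def by (intro image_eqI[of _ _ "\<lambda>w. if w = z then 1 else 0"]) auto
qed

lemma weyl_span_mono: "m \<le> n \<Longrightarrow> weyl_span m \<subseteq> weyl_span n"
proof
  fix f :: "'a poly \<Rightarrow> 'a poly" assume "m \<le> n" "f \<in> weyl_span m"
  then obtain c where f: "f = weyl_comb ({..m} \<times> {..m}) c"
    unfolding weyl_span_def by blast
  have "weyl_comb ({..m} \<times> {..m}) c \<in> weyl_span n"
    unfolding weyl_comb_def[abs_def] using \<open>m \<le> n\<close>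
    by (intro weyl_span_sum weyl_span_smult weyl_monom_in_span) auto
  then show "f \<in> weyl_span n" by (simp add: f)
qed

lemma weyl_span_comp:
  assumes g: "g \<in> weyl_span n"
    and h: "\<And>z. z \<in> {..n} \<times> {..n} \<Longrightarrow> weyl_monom z \<circ> f \<in> weyl_span m"
  shows "g \<circ> f \<in> weyl_span m"
proof -
  obtain c where c: "g = weyl_comb ({..n} \<times> {..n}) c"
    using g unfolding weyl_span_def by blast
  have "(\<lambda>p. \<Sum>z\<in>{..n} \<times> {..n}. Polynomial.smult (c z) ((weyl_monom z \<circ> f) p)) \<in> weyl_span m"
    by (intro weyl_span_sum weyl_span_smult h)
  then show ?thesis
    by (simp add: c comp_def weyl_comb_def[abs_def])
qed

lemma weyl_span_boundI:
  fixes f :: "'k::field poly \<Rightarrow> 'k poly"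
  assumes "\<And>n z. z \<in> {..n} \<times> {..n} \<Longrightarrow> weyl_monom z \<circ> f \<in> weyl_span (n + d)"
  shows "\<exists>d. \<forall>n. \<forall>g\<in>weyl_span n. g \<circ> f \<in> weyl_span (n + d)"
proof (rule exI[of _ d], intro allI ballI)
  fix n and g :: "'k poly \<Rightarrow> 'k poly" assume "g \<in> weyl_span n"
  then show "g \<circ> f \<in> weyl_span (n + d)"
    by (rule weyl_span_comp) (rule assms)
qed

text \<open>Iterated commutation rule that restores normal order. At \<open>j = 0\<close> the
  truncated \<open>j - 1\<close> is harmless, since its coefficient is zero.\<close>

lemma pderiv_power_mult_X:
  "(pderiv ^^ j) (mult_X p) =
     mult_X ((pderiv ^^ j) p) + Polynomial.smult (of_nat j) ((pderiv ^^ (j - 1)) p)"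
proof (induction j)
  case (Suc j)
  have "pderiv (Polynomial.smult (of_nat j) ((pderiv ^^ (j - 1)) p)) =
      Polynomial.smult (of_nat j) ((pderiv ^^ j) p)"
    by (cases j) (simp_all add: pderiv_smult)
  moreover have "pderiv (mult_X q) = mult_X (pderiv q) + q" for q :: "'a poly"
    by (simp add: mult_X_def pderiv_pCons)
  ultimately show ?case
    using Suc by (simp add: pderiv_add smult_add_left)
qed simp

text \<open>The order of quantifiers matters: \<open>d\<close> depends on \<open>f\<close> but not
  on \<open>n\<close>, so right multiplication enlarges the squares only by a bounded margin. Under
  composition the margins add.\<close>

lemma weyl_span_bound:
  fixes f :: "'k::field poly \<Rightarrow> 'k poly"
  assumes "f \<in> Weyl_ops"
  shows "\<exists>d. \<forall>n. \<forall>g\<in>weyl_span n. g \<circ> f \<in> weyl_span (n + d)"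
  using assms
proof (induction rule: Weyl_induct)
  case mult_X
  have "weyl_monom z \<circ> (mult_X :: 'k poly \<Rightarrow> 'k poly) \<in> weyl_span (n + 1)" if "z \<in> {..n} \<times> {..n}" for z n
  proof -
    obtain i j where z: "z = (i, j)" by (cases z)
    have "weyl_monom z \<circ> mult_X =
        (\<lambda>p. weyl_monom (Suc i, j) p + Polynomial.smult (of_nat j :: 'k) (weyl_monom (i, j - 1) p))"
      by (rule ext, simp only: weyl_monom_def z comp_apply fst_conv snd_conv pderiv_power_mult_X)
        (simp add: mult_X_def monom_Suc distrib_left)
    moreover have "\<dots> \<in> weyl_span (n + 1)"
      using that z by (intro weyl_span_add weyl_span_smult weyl_monom_in_span) auto
    ultimately show ?thesis by simp
  qed
  then show ?case by (rule weyl_span_boundI)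
next
  case pderiv
  have "weyl_monom z \<circ> (pderiv :: 'k poly \<Rightarrow> 'k poly) \<in> weyl_span (n + 1)" if "z \<in> {..n} \<times> {..n}" for z n
  proof -
    have "weyl_monom z \<circ> pderiv = (weyl_monom (fst z, Suc (snd z)) :: 'k poly \<Rightarrow> 'k poly)"
      by (rule ext) (simp only: weyl_monom_def comp_apply fst_conv snd_conv funpow_Suc_right)
    then show ?thesis
      using that weyl_monom_in_span[of "(fst z, Suc (snd z))" "n + 1"] by auto
  qed
  then show ?case by (rule weyl_span_boundI)
next
  case (scalar k)
  have "weyl_monom z \<circ> Polynomial.smult k \<in> weyl_span (n + 0)" if "z \<in> {..n} \<times> {..n}" for z n
  proof -
    have "weyl_monom z \<circ> Polynomial.smult k = (\<lambda>p. Polynomial.smult k (weyl_monom z p))"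
      using Weyl_linear[OF weyl_monom_in_Weyl[of z]] by (auto simp: linear_smult_iff fun_eq_iff)
    then show ?thesis
      using that weyl_span_smult[OF weyl_monom_in_span] by simp
  qed
  then show ?case by (rule weyl_span_boundI)
next
  case (add f h)
  then obtain d e where d: "\<And>n g. g \<in> weyl_span n \<Longrightarrow> g \<circ> f \<in> weyl_span (n + d)"
    and e: "\<And>n g. g \<in> weyl_span n \<Longrightarrow> g \<circ> h \<in> weyl_span (n + e)"
    by blast
  have "weyl_monom z \<circ> (\<lambda>p. f p + h p) \<in> weyl_span (n + (d + e))" if z: "z \<in> {..n} \<times> {..n}" for z n
  proof -
    have "weyl_monom z \<circ> (\<lambda>p. f p + h p) = (\<lambda>p. (weyl_monom z \<circ> f) p + (weyl_monom z \<circ> h) p)"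
      using Weyl_linear[OF weyl_monom_in_Weyl[of z]] by (auto simp: linear_smult_iff fun_eq_iff)
    moreover have "\<dots> \<in> weyl_span (n + (d + e))"
    proof (rule weyl_span_add)
      show "weyl_monom z \<circ> f \<in> weyl_span (n + (d + e))"
        using d[OF weyl_monom_in_span[OF z]] weyl_span_mono[of "n + d" "n + (d + e)"] by auto
      show "weyl_monom z \<circ> h \<in> weyl_span (n + (d + e))"
        using e[OF weyl_monom_in_span[OF z]] weyl_span_mono[of "n + e" "n + (d + e)"] by auto
    qed
    ultimately show ?thesis by simp
  qed
  then show ?case by (rule weyl_span_boundI)
next
  case (comp f h)
  then show ?case by (metis add.assoc comp_assoc)
qed

lemma pderiv_power_monom_eq_0: "n < l \<Longrightarrow> (pderiv ^^ l) (monom (c :: 'k::field) n) = 0"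
proof (induction l arbitrary: n c)
  case (Suc l)
  show ?case
  proof (cases n)
    case 0
    have "(pderiv ^^ l) (0 :: 'k poly) = 0"
      by (induction l) simp_all
    then show ?thesis
      using 0 by (simp add: funpow_Suc_right pderiv_monom del: funpow.simps)
  next
    case (Suc m)
    then show ?thesis
      using Suc.IH[of m] Suc.prems by (simp add: funpow_Suc_right pderiv_monom del: funpow.simps)
  qed
qed simp

lemma pderiv_power_monom_same: "(pderiv ^^ n) (monom (c :: 'k::field_char_0) n) = monom (c * fact n) 0"
proof (induction n arbitrary: c)
  case (Suc n)
  show ?case
    by (simp add: funpow_Suc_right pderiv_monom Suc algebra_simps del: funpow.simps)
qed simp

text \<open>Evaluate at \<open>x^j\<close>, by strong induction on \<open>j\<close>: terms with
  \<open>l > j\<close> kill \<open>x^j\<close>, those with \<open>l < j\<close> have coefficient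
  zero already, and what remains is the sum of the \<open>c (i, j) j! x^i\<close>. The factorial is
  invertible in characteristic zero.\<close>

lemma weyl_comb_independent:
  fixes c :: "nat \<times> nat \<Rightarrow> 'k::field_char_0"
  assumes zero: "weyl_comb ({..n} \<times> {..n}) c = (\<lambda>p. 0)"
  shows "\<forall>z\<in>{..n} \<times> {..n}. c z = 0"
proof -
  have "\<forall>i\<le>n. c (i, j) = 0" if "j \<le> n" for j
    using that
  proof (induction j rule: less_induct)
    case (less j)
    have "weyl_comb ({..n} \<times> {..n}) c (monom 1 j) =
        (\<Sum>i\<le>n. \<Sum>l\<le>n. Polynomial.smult (c (i, l)) (weyl_monom (i, l) (monom 1 j)))"
      unfolding weyl_comb_def by (simp add: sum.cartesian_product case_prod_unfold)
    also have "\<dots> = (\<Sum>i\<le>n. \<Sum>l\<in>{j}. Polynomial.smult (c (i, l)) (weyl_monom (i, l) (monom 1 j)))"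
    proof (rule sum.cong)
      fix i assume "i \<in> {..n}"
      have "Polynomial.smult (c (i, l)) (weyl_monom (i, l) (monom 1 j)) = 0"
        if "l \<in> {..n} - {j}" for l
      proof (cases "l < j")
        case True
        then show ?thesis using less \<open>i \<in> {..n}\<close> by simp
      next
        case False
        then have "j < l" using that by simp
        then show ?thesis by (simp add: weyl_monom_def pderiv_power_monom_eq_0)
      qed
      then show "(\<Sum>l\<le>n. Polynomial.smult (c (i, l)) (weyl_monom (i, l) (monom 1 j))) =
          (\<Sum>l\<in>{j}. Polynomial.smult (c (i, l)) (weyl_monom (i, l) (monom 1 j)))"
        using less.prems by (intro sum.mono_neutral_right) auto
    qed simp
    also have "\<dots> = (\<Sum>i\<le>n. monom (c (i, j) * fact j) i)"
      by (simp add: weyl_monom_def pderiv_power_monom_same mult_monom smult_monom)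
    finally have "(\<Sum>i\<le>n. monom (c (i, j) * fact j) i) = 0"
      using zero by simp
    then have "coeff (\<Sum>i\<le>n. monom (c (i, j) * fact j) i) k = 0" for k
      by simp
    then have sum0: "(\<Sum>i\<le>n. if i = k then c (i, j) * fact j else 0) = 0" for k
      by (simp only: coeff_sum coeff_monom)
    have "c (k, j) = 0" if "k \<le> n" for k
      using sum0[of k] that by (subst (asm) sum.delta) auto
    then show ?case by blast
  qed
  then show ?thesis by auto
qed

text \<open>
  The span of the \<open>x\<^sup>i\<partial>\<^sup>j\<close> with \<open>i, j \<le> n\<close> has dimension \<open>(n + 1)\<^sup>2\<close>, and multiplication by \<open>r\<close>
  or \<open>s\<close> on the right raises \<open>n\<close> by at most \<open>D\<close>; already \<open>n = 3 D\<close> gives \<open>2 (n + 1)\<^sup>2 > (n + D + 1)\<^sup>2\<close>.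
\<close>

lemma Weyl_left_Ore:
  fixes r s :: "'k::field_char_0 poly \<Rightarrow> 'k poly"
  assumes r: "r \<in> Weyl_ops" and s: "s \<in> Weyl_ops" "s \<noteq> (\<lambda>p. 0)"
  shows "\<exists>t\<in>Weyl_ops. \<exists>a\<in>Weyl_ops. t \<noteq> (\<lambda>p. 0) \<and> t \<circ> r = a \<circ> s"
proof -
  obtain d e where d: "\<And>n g. g \<in> weyl_span n \<Longrightarrow> g \<circ> r \<in> weyl_span (n + d)"
    and e: "\<And>n g. g \<in> weyl_span n \<Longrightarrow> g \<circ> s \<in> weyl_span (n + e)"
    using weyl_span_bound[OF r] weyl_span_bound[OF s(1)] by blast
  define D n where "D = d + e" and "n = 3 * D"
  let ?Q = "{..n} \<times> {..n}" and ?J = "{..n + D} \<times> {..n + D}"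
  \<comment> \<open>The unknowns are the coefficients of both multipliers: the tag
    \<open>False\<close> marks those of \<open>t\<close>, the tag \<open>True\<close> those of
    \<open>a\<close>.\<close>
  let ?I = "(UNIV :: bool set) \<times> ?Q"
  define h where "h b = (if b then s else r)" for b
  have h_span: "weyl_monom z \<circ> h b \<in> weyl_span (n + D)" if "z \<in> ?Q" for b z
    using d[OF weyl_monom_in_span[OF that]] e[OF weyl_monom_in_span[OF that]]
      weyl_span_mono[of "n + d" "n + D"] weyl_span_mono[of "n + e" "n + D"]
    by (auto simp: h_def D_def)
  \<comment> \<open>Coordinates of the product in the enlarged square; they form the matrix of the
    linear system.\<close>
  define M where "M b z = (SOME x. weyl_monom z \<circ> h b = weyl_comb ?J x)" for b z
  have M: "weyl_monom z \<circ> h b = weyl_comb ?J (M b z)" if "z \<in> ?Q" for b z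
    unfolding M_def by (rule someI_ex[of "\<lambda>x. weyl_monom z \<circ> h b = weyl_comb ?J x"])
      (use h_span[OF that, of b] in \<open>unfold weyl_span_def, blast\<close>)
  have "card ?J < card ?I"
    by (simp add: card_cartesian_product n_def algebra_simps)
  then obtain c where c: "\<exists>i\<in>?I. c i \<noteq> 0"
    "\<forall>j\<in>?J. (\<Sum>i\<in>?I. c i * M (fst i) (snd i) j) = 0"
    using homogeneous_system_nontrivial_solution[of ?J ?I "\<lambda>i. M (fst i) (snd i)"] by auto
  define t where "t = weyl_comb ?Q (\<lambda>z. c (False, z))"
  define a where "a = weyl_comb ?Q (\<lambda>z. c (True, z))"
  have tW: "t \<in> Weyl_ops" and aW: "a \<in> Weyl_ops"
    by (simp_all add: t_def a_def weyl_comb_in_Weyl)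
  have sum_zero: "t (r p) + a (s p) = 0" for p
  proof -
    have "t (r p) + a (s p) = (\<Sum>b\<in>UNIV. \<Sum>z\<in>?Q. Polynomial.smult (c (b, z)) (weyl_monom z (h b p)))"
      by (simp add: t_def a_def weyl_comb_def h_def UNIV_bool)
    also have "\<dots> = (\<Sum>i\<in>?I. Polynomial.smult (c i) (weyl_monom (snd i) (h (fst i) p)))"
      by (simp add: sum.cartesian_product case_prod_unfold)
    also have "\<dots> = (\<Sum>i\<in>?I. Polynomial.smult (c i) (weyl_comb ?J (M (fst i) (snd i)) p))"
    proof (rule sum.cong)
      fix i assume "i \<in> ?I"
      then have "snd i \<in> ?Q" by auto
      from fun_cong[OF M[OF this, of "fst i"], of p]
      show "Polynomial.smult (c i) (weyl_monom (snd i) (h (fst i) p)) =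
          Polynomial.smult (c i) (weyl_comb ?J (M (fst i) (snd i)) p)"
        by simp
    qed simp
    also have "\<dots> = (\<Sum>i\<in>?I. \<Sum>j\<in>?J. Polynomial.smult (c i * M (fst i) (snd i) j) (weyl_monom j p))"
      by (simp add: weyl_comb_def smult_sum_right)
    also have "\<dots> = (\<Sum>j\<in>?J. \<Sum>i\<in>?I. Polynomial.smult (c i * M (fst i) (snd i) j) (weyl_monom j p))"
      by (rule sum.swap)
    also have "\<dots> = (\<Sum>j\<in>?J. Polynomial.smult (\<Sum>i\<in>?I. c i * M (fst i) (snd i) j) (weyl_monom j p))"
      by (simp add: smult_sum)
    also have "\<dots> = 0"
      using c(2) by (intro sum.neutral) simp
    finally show ?thesis .
  qed
  have "t \<noteq> (\<lambda>p. 0)"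
  proof
    \<comment> \<open>A nontrivial solution could still be supported on \<open>a\<close>. The domain
      property excludes this: \<open>t = 0\<close> gives \<open>a s = 0\<close>, so
      \<open>a = 0\<close>, and independence kills every coefficient.\<close>
    assume t0: "t = (\<lambda>p. 0)"
    then have "a \<circ> s = (\<lambda>p. 0)"
      using sum_zero by (auto simp: fun_eq_iff)
    then have "a = (\<lambda>p. 0)"
      using Weyl_domain[OF aW s(1)] s(2) by blast
    then have "c (b, z) = 0" if "z \<in> ?Q" for b z
      using weyl_comb_independent[OF t0[unfolded t_def]]
        weyl_comb_independent[of n "\<lambda>z. c (True, z)"] that
      by (cases b) (auto simp: a_def)
    then show False using c(1) by auto
  qed
  moreover have "t \<circ> r = (\<lambda>p. - a p) \<circ> s"
    using sum_zero by (auto simp: fun_eq_iff eq_neg_iff_add_eq_0)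
  ultimately show ?thesis
    using tW minus_in_Weyl[OF aW] by blast
qed

section \<open>Clearing denominators in the Jacobian algebra\<close>

text \<open>\<open>diag_op e\<close> is the operator \<open>e(x\<partial>)\<close>.\<close>

definition diag_op :: "'k::field poly \<Rightarrow> 'k poly \<Rightarrow> 'k poly" where
  "diag_op e p = (\<Sum>k\<le>degree p. monom (poly e (of_nat k) * coeff p k) k)"

lemma coeff_diag_op [simp]: "coeff (diag_op e p) n = poly e (of_nat n) * coeff p n"
proof -
  have "coeff (diag_op e p) n = (\<Sum>k\<le>degree p. if k = n then poly e (of_nat k) * coeff p k else 0)"
    by (simp only: diag_op_def coeff_sum coeff_monom)
  also have "\<dots> = (if n \<le> degree p then poly e (of_nat n) * coeff p n else 0)"
    by (subst sum.delta) auto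
  finally show ?thesis
    by (auto simp: coeff_eq_0 not_le)
qed

lemma coeff_mult_X: "coeff (mult_X p) n = (if n = 0 then 0 else coeff p (n - 1))"
  by (cases n) (simp_all add: mult_X_def)

lemma coeff_H_op: "coeff (H_op p) n = of_nat (Suc n) * coeff p n"
  by (simp only: H_op_def comp_apply coeff_pderiv coeff_mult_X) simp

lemma diag_op_in_Weyl: "diag_op e \<in> Weyl_ops"
proof (induction e)
  case 0
  have "diag_op 0 = (\<lambda>p. 0 :: 'a poly)"
    by (rule ext) (simp add: poly_eq_iff)
  then show ?case using zero_in_Weyl by metis
next
  case (pCons a e)
  \<comment> \<open>Horner step: \<open>e(x\<partial>) = a + (x\<partial>) e'(x\<partial>)\<close>,
    where \<open>e'\<close> is the tail of \<open>e\<close>.\<close>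
  have "diag_op (pCons a e) = (\<lambda>p. Polynomial.smult a p + (mult_X \<circ> (pderiv \<circ> diag_op e)) p)"
    by (rule ext, rule poly_eqI)
      (simp add: coeff_mult_X coeff_pderiv algebra_simps split: nat.split)
  moreover have "\<dots> \<in> Weyl_ops"
    by (rule add_in_Weyl[OF scalar_in_Weyl comp_in_Weyl[OF mult_X_in_Weyl comp_in_Weyl[OF pderiv_in_Weyl pCons(2)]]])
  ultimately show ?case by metis
qed

lemma diag_op_mult: "diag_op d \<circ> diag_op e = diag_op (d * e)"
  by (rule ext, rule poly_eqI) (simp add: mult.assoc)

lemma H_op_eq_diag_op: "H_op = diag_op [:1, 1:]"
  by (rule ext, rule poly_eqI) (simp add: coeff_H_op)

lemma Weyl_smult_add:
  assumes "f \<in> Weyl_ops"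
  shows "f (Polynomial.smult c p) = Polynomial.smult c (f p)" "f (p + q) = f p + f q"
  using Weyl_linear[OF assms] by (simp_all add: linear_smult_iff)

text \<open>Moves a diagonal denominator from the left of \<open>f\<close> to its right. Passing
  \<open>x\<close> or \<open>\<partial>\<close> merely translates the argument of \<open>e\<close>
  by one, and diagonal operators commute with each other.\<close>

lemma diag_op_right_Ore:
  fixes f :: "'k::field_char_0 poly \<Rightarrow> 'k poly"
  assumes "f \<in> Weyl_ops" "e \<noteq> 0"
  shows "\<exists>d a. d \<noteq> 0 \<and> a \<in> Weyl_ops \<and> f \<circ> diag_op d = diag_op e \<circ> a"
proof -
  have "\<forall>e. e \<noteq> 0 \<longrightarrow> (\<exists>d a. d \<noteq> 0 \<and> a \<in> Weyl_ops \<and> f \<circ> diag_op d = diag_op e \<circ> a)"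
    using assms(1)
  proof (induction rule: Weyl_induct)
    case mult_X
    have "mult_X \<circ> diag_op (e \<circ>\<^sub>p [:1, 1:]) = diag_op e \<circ> mult_X" for e :: "'k poly"
      by (rule ext, rule poly_eqI) (auto simp: coeff_mult_X poly_pcompose of_nat_diff gr0_conv_Suc)
    moreover have "e \<circ>\<^sub>p [:1, 1:] \<noteq> 0" if "e \<noteq> 0" for e :: "'k poly"
      using that by (simp add: pcompose_eq_0_iff)
    ultimately show ?case using mult_X_in_Weyl by blast
  next
    case pderiv
    have "pderiv \<circ> diag_op (e \<circ>\<^sub>p [:-1, 1:]) = diag_op e \<circ> pderiv" for e :: "'k poly"
      by (rule ext, rule poly_eqI) (simp add: coeff_pderiv poly_pcompose)
    moreover have "e \<circ>\<^sub>p [:-1, 1:] \<noteq> 0" if "e \<noteq> 0" for e :: "'k poly"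
      using that by (simp add: pcompose_eq_0_iff)
    ultimately show ?case using pderiv_in_Weyl by blast
  next
    case (scalar k)
    have "Polynomial.smult k \<circ> diag_op e = diag_op e \<circ> Polynomial.smult k" for e :: "'k poly"
      by (rule ext, rule poly_eqI) simp
    then show ?case using scalar_in_Weyl by blast
  next
    case (add f g)
    show ?case
    proof (intro allI impI)
      fix e :: "'k poly" assume e: "e \<noteq> 0"
      obtain d a d' a' where
        d: "d \<noteq> 0" "a \<in> Weyl_ops" "f \<circ> diag_op d = diag_op e \<circ> a" and
        d': "d' \<noteq> 0" "a' \<in> Weyl_ops" "g \<circ> diag_op d' = diag_op e \<circ> a'"
        using add.IH(1)[rule_format, OF e] add.IH(2)[rule_format, OF e] by blast
      \<comment> \<open>The product \<open>d * d'\<close> is a common right denominator; by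
        commutativity either factor can be applied first.\<close>
      let ?a = "\<lambda>p. (a \<circ> diag_op d') p + (a' \<circ> diag_op d) p"
      have "(\<lambda>p. f p + g p) \<circ> diag_op (d * d') = diag_op e \<circ> ?a"
      proof
        fix p
        have "(f \<circ> diag_op (d * d')) p = (f \<circ> diag_op d) (diag_op d' p)"
          by (simp only: comp_apply diag_op_mult[symmetric])
        moreover have "(g \<circ> diag_op (d * d')) p = (g \<circ> diag_op d') (diag_op d p)"
          by (simp only: comp_apply diag_op_mult[symmetric] mult.commute[of d])
        ultimately show "((\<lambda>p. f p + g p) \<circ> diag_op (d * d')) p = (diag_op e \<circ> ?a) p"
          unfolding d(3) d'(3) by (simp add: Weyl_smult_add(2)[OF diag_op_in_Weyl])
      qed
      moreover have "?a \<in> Weyl_ops"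
        by (rule add_in_Weyl[OF comp_in_Weyl[OF d(2) diag_op_in_Weyl] comp_in_Weyl[OF d'(2) diag_op_in_Weyl]])
      moreover have "d * d' \<noteq> 0"
        using d(1) d'(1) by simp
      ultimately show "\<exists>d a. d \<noteq> 0 \<and> a \<in> Weyl_ops \<and> (\<lambda>p. f p + g p) \<circ> diag_op d = diag_op e \<circ> a"
        by blast
    qed
  next
    case (comp f g)
    show ?case
    proof (intro allI impI)
      fix e :: "'k poly" assume e: "e \<noteq> 0"
      obtain d a where d: "d \<noteq> 0" "a \<in> Weyl_ops" "f \<circ> diag_op d = diag_op e \<circ> a"
        using comp.IH(1)[rule_format, OF e] by blast
      obtain d' a' where d': "d' \<noteq> 0" "a' \<in> Weyl_ops" "g \<circ> diag_op d' = diag_op d \<circ> a'"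
        using comp.IH(2)[rule_format, OF d(1)] by blast
      have "f \<circ> g \<circ> diag_op d' = diag_op e \<circ> (a \<circ> a')"
        using d(3) d'(3) by (metis comp_assoc)
      then show "\<exists>d a. d \<noteq> 0 \<and> a \<in> Weyl_ops \<and> f \<circ> g \<circ> diag_op d = diag_op e \<circ> a"
        using d'(1) comp_in_Weyl[OF d(2) d'(2)] by blast
    qed
  qed
  then show ?thesis using assms(2) by blast
qed

section \<open>The Jacobian algebra and its one-sided denominators\<close>

abbreviation Jacobian_ops :: "('k::field_char_0 poly \<Rightarrow> 'k poly) set" where
  "Jacobian_ops \<equiv> carrier Jacobian_algebra"

lemma bij_H_op: "bij (H_op :: 'k::field_char_0 poly \<Rightarrow> 'k poly)"
proof (rule bijI)
  show "inj (H_op :: 'k poly \<Rightarrow> 'k poly)"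
  proof (rule injI)
    fix p q :: "'k poly" assume "H_op p = H_op q"
    then have "of_nat (Suc n) * coeff p n = of_nat (Suc n) * coeff q n" for n
      by (simp only: flip: coeff_H_op)
    then show "p = q"
      by (intro poly_eqI) (simp del: of_nat_Suc)
  qed
  show "surj (H_op :: 'k poly \<Rightarrow> 'k poly)"
  proof (rule surjI)
    fix q :: "'k poly"
    show "H_op (\<Sum>k\<le>degree q. monom (coeff q k / of_nat (Suc k)) k) = q"
    proof (rule poly_eqI)
      fix n
      have "coeff (\<Sum>k\<le>degree q. monom (coeff q k / of_nat (Suc k)) k) n =
          (\<Sum>k\<le>degree q. if k = n then coeff q k / of_nat (Suc k) else 0)"
        by (simp only: coeff_sum coeff_monom)
      also have "\<dots> = (if n \<le> degree q then coeff q n / of_nat (Suc n) else 0)"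
        by (subst sum.delta) auto
      finally show "coeff (H_op (\<Sum>k\<le>degree q. monom (coeff q k / of_nat (Suc k)) k)) n = coeff q n"
        unfolding coeff_H_op by (auto simp: coeff_eq_0 not_le simp del: of_nat_Suc)
    qed
  qed
qed

lemma H_op_inverse: "H_op (the_inv H_op p) = p" "the_inv H_op (H_op p) = p"
  for p :: "'k::field_char_0 poly"
  using bij_H_op[where ?'k = 'k] by (auto simp: bij_def f_the_inv_into_f the_inv_f_f)

lemma H_op_in_Weyl: "H_op \<in> Weyl_ops"
  unfolding H_op_eq_diag_op by (rule diag_op_in_Weyl)

lemma linear_the_inv_H_op: "(the_inv H_op :: 'k::field_char_0 poly \<Rightarrow> 'k poly) \<in> carrier End_poly"
  unfolding End_poly_simps linear_smult_iff
proof (intro conjI allI)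
  note lin = Weyl_smult_add[OF H_op_in_Weyl]
  fix p q :: "'k poly" and c
  show "the_inv H_op (p + q) = the_inv H_op p + the_inv H_op q"
    by (metis H_op_inverse lin(2))
  show "the_inv H_op (Polynomial.smult c p) = Polynomial.smult c (the_inv H_op p)"
    by (metis H_op_inverse lin(1))
qed

lemma carrier_Jacobian_algebra:
  "Jacobian_ops = generate_ring End_poly (Weyl_ops \<union> {the_inv H_op} \<union> range Polynomial.smult)"
  by (simp add: Jacobian_algebra_def generate_algebra_def)

lemma Jacobian_generators_carrier:
  "Weyl_ops \<union> {the_inv H_op} \<union> range Polynomial.smult \<subseteq> (carrier End_poly :: ('k::field_char_0 poly \<Rightarrow> 'k poly) set)"
  by (auto simp: Weyl_linear linear_the_inv_H_op[unfolded End_poly_simps] linear_scalar[unfolded End_poly_simps])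

lemma Jacobian_linear: "f \<in> Jacobian_ops \<Longrightarrow> Vector_Spaces.linear Polynomial.smult Polynomial.smult f"
  using End_poly.generate_ring_in_carrier[OF Jacobian_generators_carrier] End_poly_simps(1)
  unfolding carrier_Jacobian_algebra by blast

lemma Weyl_subset_Jacobian: "Weyl_ops \<subseteq> Jacobian_ops"
  unfolding carrier_Jacobian_algebra by (auto intro!: generate_ring.incl)

lemma Jacobian_induct [consumes 1, case_names Weyl inverse add comp]:
  fixes f :: "'k::field_char_0 poly \<Rightarrow> 'k poly"
  assumes f: "f \<in> Jacobian_ops"
    and gens: "\<And>f. f \<in> Weyl_ops \<Longrightarrow> P f" "P (the_inv H_op)"
    and add: "\<And>f g. f \<in> Jacobian_ops \<Longrightarrow> g \<in> Jacobian_ops \<Longrightarrow> P f \<Longrightarrow> P g \<Longrightarrow> P (\<lambda>p. f p + g p)"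
    and comp: "\<And>f g. f \<in> Jacobian_ops \<Longrightarrow> g \<in> Jacobian_ops \<Longrightarrow> P f \<Longrightarrow> P g \<Longrightarrow> P (f \<circ> g)"
  shows "P f"
  using f unfolding carrier_Jacobian_algebra
proof (induction rule: generate_ring.induct)
  case one
  then show ?case using gens(1)[OF id_in_Weyl] by (simp only: End_poly_simps)
next
  case (incl h)
  then show ?case using gens scalar_in_Weyl by auto
next
  case (a_inv h)
  then have "h \<in> Jacobian_ops" by (simp add: carrier_Jacobian_algebra)
  moreover have "\<ominus>\<^bsub>End_poly\<^esub> h = Polynomial.smult (-1) \<circ> h"
    using Jacobian_linear[OF \<open>h \<in> Jacobian_ops\<close>] by (simp add: a_inv_End_poly fun_eq_iff)
  moreover have "(Polynomial.smult (-1) :: 'k poly \<Rightarrow> 'k poly) \<in> Jacobian_ops"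
    using scalar_in_Weyl Weyl_subset_Jacobian by blast
  ultimately show ?case using comp gens(1)[OF scalar_in_Weyl] a_inv.IH by metis
next
  case (eng_add f g)
  then show ?case using add[of f g] by (simp add: carrier_Jacobian_algebra)
next
  case (eng_mult f g)
  then show ?case using comp[of f g] by (simp only: End_poly_simps carrier_Jacobian_algebra)
qed

lemma comp_in_Jacobian: "f \<in> Jacobian_ops \<Longrightarrow> g \<in> Jacobian_ops \<Longrightarrow> f \<circ> g \<in> Jacobian_ops"
  using generate_ring.eng_mult[of f End_poly _ g] by (simp add: carrier_Jacobian_algebra)

lemma smult_in_Jacobian: "f \<in> Jacobian_ops \<Longrightarrow> (\<lambda>p. Polynomial.smult k (f p)) \<in> Jacobian_ops"
  using comp_in_Jacobian[of "Polynomial.smult k" f] scalar_in_Weyl Weyl_subset_Jacobian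
  by (auto simp: comp_def)

lemma Weyl_comp_nonzero:
  fixes f g :: "'k::field_char_0 poly \<Rightarrow> 'k poly"
  shows "f \<in> Weyl_ops \<Longrightarrow> g \<in> Weyl_ops \<Longrightarrow> f \<noteq> (\<lambda>p. 0) \<Longrightarrow> g \<noteq> (\<lambda>p. 0) \<Longrightarrow> f \<circ> g \<noteq> (\<lambda>p. 0)"
  using Weyl_domain by blast

lemma H_op_nonzero: "H_op \<noteq> (\<lambda>p. 0 :: 'k::field_char_0 poly)"
  using H_op_inverse(1)[of "1 :: 'k poly"] by (metis zero_neq_one)

lemma id_nonzero: "id \<noteq> (\<lambda>p. 0 :: 'k::field poly)"
  by (metis id_apply one_neq_zero)

text \<open>Quantifying over the left factor \<open>v\<close> lets the induction pass through products.\<close>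

lemma Jacobian_clear_left:
  fixes r :: "'k::field_char_0 poly \<Rightarrow> 'k poly"
  assumes "r \<in> Jacobian_ops" "v \<in> Weyl_ops"
  shows "\<exists>u\<in>Weyl_ops. u \<noteq> (\<lambda>p. 0) \<and> u \<circ> v \<circ> r \<in> Weyl_ops"
proof -
  have "\<forall>v\<in>Weyl_ops. \<exists>u\<in>Weyl_ops. u \<noteq> (\<lambda>p. 0) \<and> u \<circ> v \<circ> r \<in> Weyl_ops"
    using assms(1)
  proof (induction rule: Jacobian_induct)
    case (Weyl f)
    then show ?case
      using id_in_Weyl id_nonzero comp_in_Weyl by (metis id_comp)
  next
    case inverse
    show ?case
    proof
      fix v :: "'k poly \<Rightarrow> 'k poly" assume "v \<in> Weyl_ops"
      then obtain u a where u: "u \<in> Weyl_ops" "a \<in> Weyl_ops" "u \<noteq> (\<lambda>p. 0)" "u \<circ> v = a \<circ> H_op"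
        using Weyl_left_Ore[OF _ H_op_in_Weyl H_op_nonzero] by blast
      have "u \<circ> v \<circ> the_inv H_op = a"
        unfolding u(4) by (simp add: fun_eq_iff H_op_inverse)
      then show "\<exists>u\<in>Weyl_ops. u \<noteq> (\<lambda>p. 0) \<and> u \<circ> v \<circ> the_inv H_op \<in> Weyl_ops"
        using u by metis
    qed
  next
    case (add f g)
    show ?case
    proof
      fix v :: "'k poly \<Rightarrow> 'k poly" assume v: "v \<in> Weyl_ops"
      obtain u where u: "u \<in> Weyl_ops" "u \<noteq> (\<lambda>p. 0)" "u \<circ> v \<circ> f \<in> Weyl_ops"
        using add.IH(1) v by blast
      \<comment> \<open>Taking \<open>u v\<close> as the left factor for \<open>g\<close> yields a
        multiplier \<open>w u\<close> that clears both summands.\<close>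
      obtain w where w: "w \<in> Weyl_ops" "w \<noteq> (\<lambda>p. 0)" "w \<circ> (u \<circ> v) \<circ> g \<in> Weyl_ops"
        using add.IH(2) comp_in_Weyl[OF u(1) v] by blast
      have "(\<lambda>p. (w \<circ> (u \<circ> v \<circ> f)) p + (w \<circ> (u \<circ> v) \<circ> g) p) \<in> Weyl_ops"
        by (intro add_in_Weyl comp_in_Weyl[OF w(1)] u w)
      also have "(\<lambda>p. (w \<circ> (u \<circ> v \<circ> f)) p + (w \<circ> (u \<circ> v) \<circ> g) p) = w \<circ> u \<circ> v \<circ> (\<lambda>p. f p + g p)"
        using Weyl_smult_add(2)[OF w(1)] Weyl_smult_add(2)[OF u(1)] Weyl_smult_add(2)[OF v]
        by (simp add: fun_eq_iff)
      finally show "\<exists>u\<in>Weyl_ops. u \<noteq> (\<lambda>p. 0) \<and> u \<circ> v \<circ> (\<lambda>p. f p + g p) \<in> Weyl_ops"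
        using comp_in_Weyl[OF w(1) u(1)] Weyl_comp_nonzero[OF w(1) u(1) w(2) u(2)] by blast
    qed
  next
    case (comp f g)
    show ?case
    proof
      fix v :: "'k poly \<Rightarrow> 'k poly" assume v: "v \<in> Weyl_ops"
      obtain u where u: "u \<in> Weyl_ops" "u \<noteq> (\<lambda>p. 0)" "u \<circ> v \<circ> f \<in> Weyl_ops"
        using comp.IH(1) v by blast
      obtain w where w: "w \<in> Weyl_ops" "w \<noteq> (\<lambda>p. 0)" "w \<circ> (u \<circ> v \<circ> f) \<circ> g \<in> Weyl_ops"
        using comp.IH(2) u(3) by blast
      have "w \<circ> u \<circ> v \<circ> (f \<circ> g) \<in> Weyl_ops"
        using w(3) by (simp only: comp_assoc)
      then show "\<exists>u\<in>Weyl_ops. u \<noteq> (\<lambda>p. 0) \<and> u \<circ> v \<circ> (f \<circ> g) \<in> Weyl_ops"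
        using comp_in_Weyl[OF w(1) u(1)] Weyl_comp_nonzero[OF w(1) u(1) w(2) u(2)] by blast
    qed
  qed
  then show ?thesis using assms(2) by blast
qed

text \<open>The right denominator can be taken diagonal because \<open>H_op\<close> is diagonal and
  \<open>diag_op_right_Ore\<close> moves it past any Weyl operator. Diagonality permits evaluation
  on single monomials later. The factor \<open>w\<close> carries the induction through
  products.\<close>

lemma Jacobian_clear_right:
  fixes r :: "'k::field_char_0 poly \<Rightarrow> 'k poly"
  assumes "r \<in> Jacobian_ops" "w \<in> Weyl_ops"
  shows "\<exists>d. d \<noteq> 0 \<and> r \<circ> w \<circ> diag_op d \<in> Weyl_ops"
proof -
  have "\<forall>w\<in>Weyl_ops. \<exists>d. d \<noteq> 0 \<and> r \<circ> w \<circ> diag_op d \<in> Weyl_ops"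
    using assms(1)
  proof (induction rule: Jacobian_induct)
    case (Weyl f)
    then show ?case
      using comp_in_Weyl diag_op_in_Weyl by (metis one_neq_zero)
  next
    case inverse
    show ?case
    proof
      fix w :: "'k poly \<Rightarrow> 'k poly" assume "w \<in> Weyl_ops"
      then obtain d a where d: "d \<noteq> 0" "a \<in> Weyl_ops" "w \<circ> diag_op d = H_op \<circ> a"
        using diag_op_right_Ore[of w "[:1, 1:]"] unfolding H_op_eq_diag_op by auto
      have "the_inv H_op \<circ> w \<circ> diag_op d = a"
        unfolding comp_assoc d(3) by (simp add: fun_eq_iff H_op_inverse)
      then show "\<exists>d. d \<noteq> 0 \<and> the_inv H_op \<circ> w \<circ> diag_op d \<in> Weyl_ops"
        using d by metis
    qed
  next
    case (add f g)
    show ?case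
    proof
      fix w :: "'k poly \<Rightarrow> 'k poly" assume w: "w \<in> Weyl_ops"
      obtain d where d: "d \<noteq> 0" "f \<circ> w \<circ> diag_op d \<in> Weyl_ops"
        using add.IH(1) w by blast
      obtain e where e: "e \<noteq> 0" "g \<circ> w \<circ> diag_op e \<in> Weyl_ops"
        using add.IH(2) w by blast
      have "f \<circ> w \<circ> diag_op (d * e) = f \<circ> w \<circ> diag_op d \<circ> diag_op e"
        "g \<circ> w \<circ> diag_op (d * e) = g \<circ> w \<circ> diag_op e \<circ> diag_op d"
        by (simp_all only: comp_assoc diag_op_mult mult.commute)
      then have "f \<circ> w \<circ> diag_op (d * e) \<in> Weyl_ops" "g \<circ> w \<circ> diag_op (d * e) \<in> Weyl_ops"
        using comp_in_Weyl[OF d(2) diag_op_in_Weyl] comp_in_Weyl[OF e(2) diag_op_in_Weyl] by metis+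
      from add_in_Weyl[OF this] have "(\<lambda>p. f p + g p) \<circ> w \<circ> diag_op (d * e) \<in> Weyl_ops"
        by (simp add: comp_def)
      moreover have "d * e \<noteq> 0" using d e by simp
      ultimately show "\<exists>d. d \<noteq> 0 \<and> (\<lambda>p. f p + g p) \<circ> w \<circ> diag_op d \<in> Weyl_ops"
        by blast
    qed
  next
    case (comp f g)
    show ?case
    proof
      fix w :: "'k poly \<Rightarrow> 'k poly" assume w: "w \<in> Weyl_ops"
      obtain d where d: "d \<noteq> 0" "g \<circ> w \<circ> diag_op d \<in> Weyl_ops"
        using comp.IH(2) w by blast
      obtain e where e: "e \<noteq> 0" "f \<circ> (g \<circ> w \<circ> diag_op d) \<circ> diag_op e \<in> Weyl_ops"
        using comp.IH(1) d(2) by blast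
      have "f \<circ> g \<circ> w \<circ> diag_op (d * e) \<in> Weyl_ops"
        using e(2) by (simp only: comp_assoc diag_op_mult)
      moreover have "d * e \<noteq> 0" using d e by simp
      ultimately show "\<exists>d. d \<noteq> 0 \<and> f \<circ> g \<circ> w \<circ> diag_op d \<in> Weyl_ops"
        by blast
    qed
  qed
  then show ?thesis using assms(2) by blast
qed

text \<open>Such an \<open>r\<close> need not be zero, as the projection onto the constants killed
  by \<open>\<partial>\<close> shows. But \<open>r d(x\<partial>)\<close> lies in the Weyl algebra
  for some \<open>d\<close>, where \<open>u\<close> can be cancelled; hence
  \<open>d(k) r(x^k) = 0\<close>, and \<open>d\<close> has finitely many roots.\<close>

lemma Jacobian_annihilated_eventually_zero:
  fixes r u :: "'k::field_char_0 poly \<Rightarrow> 'k poly"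
  assumes r: "r \<in> Jacobian_ops" and u: "u \<in> Weyl_ops" "u \<noteq> (\<lambda>p. 0)" and ur: "u \<circ> r = (\<lambda>p. 0)"
  shows "\<exists>K. \<forall>k\<ge>K. r (monom 1 k) = 0"
proof -
  obtain d where d: "d \<noteq> 0" "r \<circ> id \<circ> diag_op d \<in> Weyl_ops"
    using Jacobian_clear_right[OF r id_in_Weyl] by blast
  have "u \<circ> (r \<circ> id \<circ> diag_op d) = (\<lambda>p. 0)"
    using fun_cong[OF ur] by (simp add: fun_eq_iff)
  then have zero: "r \<circ> id \<circ> diag_op d = (\<lambda>p. 0)"
    using Weyl_domain[OF u(1) d(2)] u(2) by blast
  obtain K where K: "\<And>k. k \<ge> K \<Longrightarrow> poly d (of_nat k) \<noteq> 0"
    using eventually_poly_of_nat_nonzero[OF d(1)] by blast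
  have "r (monom 1 k) = 0" if "k \<ge> K" for k
  proof -
    have "diag_op d (monom 1 k) = Polynomial.smult (poly d (of_nat k)) (monom 1 k)"
      by (rule poly_eqI) (auto simp: coeff_monom)
    then have "Polynomial.smult (poly d (of_nat k)) (r (monom 1 k)) = 0"
      using fun_cong[OF zero, of "monom 1 k"] Jacobian_linear[OF r] by (simp add: linear_smult_iff)
    then show ?thesis using K[OF that] by simp
  qed
  then show ?thesis by blast
qed

lemma pderiv_power_comp_left_regular:
  fixes t :: "'k::field_char_0 poly \<Rightarrow> 'k poly"
  assumes t: "t \<in> Weyl_ops" "t \<noteq> (\<lambda>p. 0)"
  shows "\<exists>a. \<forall>r\<in>Jacobian_ops. r \<circ> (pderiv ^^ a \<circ> t) = (\<lambda>p. 0) \<longrightarrow> r = (\<lambda>p. 0)"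
proof -
  obtain a b where ab: "\<And>m q. has_order (m + b) q \<Longrightarrow> has_order (m + a) (t q)"
    using Weyl_order[OF t] by blast
  let ?t = "pderiv ^^ a \<circ> t"
  have tW: "?t \<in> Weyl_ops"
    by (rule comp_in_Weyl[OF pderiv_power_in_Weyl t(1)])
  \<comment> \<open>The power \<open>a\<close> is the order offset of \<open>t\<close>. Removing it
    fills the gap at low orders, so that the image contains an element of every order, including
    0.\<close>
  have order: "has_order m (?t (monom 1 (m + b)))" for m
    using has_order_pderiv_power[OF ab[OF has_order_monom]] by simp
  have t0: "?t \<noteq> (\<lambda>p. 0)"
    using has_order_nonzero[OF order[of 0]] by metis
  have "r = (\<lambda>p. 0)" if r: "r \<in> Jacobian_ops" and rt: "r \<circ> ?t = (\<lambda>p. 0)" for r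
  proof -
    obtain u where u: "u \<in> Weyl_ops" "u \<noteq> (\<lambda>p. 0)" "u \<circ> id \<circ> r \<in> Weyl_ops"
      using Jacobian_clear_left[OF r id_in_Weyl] by blast
    have "u (r (?t p)) = 0" for p
      using fun_cong[OF rt, of p] Weyl_linear[OF u(1)] Weyl_smult_add(1)[OF u(1), of 0 0] by simp
    then have "(u \<circ> id \<circ> r) \<circ> ?t = (\<lambda>p. 0)"
      by (simp add: fun_eq_iff)
    then have "u \<circ> r = (\<lambda>p. 0)"
      using Weyl_domain[OF u(3) tW] t0 by (simp only: comp_id) blast
    then obtain K where K: "\<And>k. k \<ge> K \<Longrightarrow> r (monom 1 k) = 0"
      using Jacobian_annihilated_eventually_zero[OF r u(1,2)] by blast
    \<comment> \<open>Descending induction from \<open>K\<close>; the subtraction is truncated, so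
      \<open>m = K\<close> covers all exponents.\<close>
    have "\<forall>k\<ge>K - m. r (monom 1 k) = 0" for m
    proof (induction m)
      case 0
      then show ?case using K by simp
    next
      case (Suc m)
      show ?case
      proof (cases "m < K")
        case True
        define l where "l = K - Suc m"
        let ?q = "?t (monom 1 (l + b))"
        \<comment> \<open>Below \<open>l\<close> the coefficients of \<open>?q\<close> vanish by its
          order, above \<open>l\<close> the operator \<open>r\<close> vanishes by induction; so
          \<open>r ?q = 0\<close> isolates \<open>r(x^l)\<close>.\<close>
        have rest: "coeff ?q k \<noteq> 0 \<Longrightarrow> k \<noteq> l \<Longrightarrow> r (monom 1 k) = 0" for k
          using order[of l] Suc True by (auto simp: has_order_def l_def) (metis Suc_diff_Suc not_less_eq linorder_neqE_nat not_le)
        have "0 = r ?q"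
          using fun_cong[OF rt, of "monom 1 (l + b)"] by simp
        also have "\<dots> = (\<Sum>k\<le>degree ?q. Polynomial.smult (coeff ?q k) (r (monom 1 k)))"
          by (rule linear_as_sum[OF Jacobian_linear[OF r]])
        also have "\<dots> = (\<Sum>k\<in>{l}. Polynomial.smult (coeff ?q k) (r (monom 1 k)))"
        proof (rule sum.mono_neutral_right)
          show "{l} \<subseteq> {..degree ?q}"
            using order[of l] by (auto simp: has_order_def intro: le_degree)
        qed (use rest in auto)
        finally have "r (monom 1 l) = 0"
          using order[of l] by (simp add: has_order_def)
        moreover have "k = l \<or> K - m \<le> k" if "K - Suc m \<le> k" for k
          using that by (auto simp: l_def)
        ultimately show ?thesis using Suc by auto
      next
        case False
        then show ?thesis using Suc by simp
      qed
    qed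
    from this[of K] show ?thesis
      using linear_zero_iff[OF Jacobian_linear[OF r]] by simp
  qed
  then show ?thesis by blast
qed

section \<open>The two quotient rings\<close>

lemma Jacobian_algebra_simps:
  "monoid.mult Jacobian_algebra = (\<lambda>f g :: 'k::field_char_0 poly \<Rightarrow> 'k poly. f \<circ> g)"
  "one Jacobian_algebra = (id :: 'k poly \<Rightarrow> 'k poly)"
  "zero Jacobian_algebra = (\<lambda>p :: 'k poly. 0)"
  "add Jacobian_algebra = (\<lambda>(f :: 'k poly \<Rightarrow> 'k poly) g p. f p + g p)"
  "module.smult Jacobian_algebra = (\<lambda>k (f :: 'k poly \<Rightarrow> 'k poly) p. Polynomial.smult k (f p))"
  by (simp_all add: Jacobian_algebra_def End_poly_def)

text \<open>Puts the Weyl algebra in the form \<open>R\<lparr>carrier := B\<rparr>\<close> demanded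
  by \<open>left_localization_subalgebra_iso\<close>.\<close>

lemma Weyl_algebra_eq: "Weyl_algebra = Jacobian_algebra\<lparr>carrier := Weyl_ops\<rparr>"
  by (simp add: Jacobian_algebra_def Weyl_algebra_def)

lemma Weyl_algebra_simps:
  "monoid.mult Weyl_algebra = (\<lambda>f g :: 'k::field poly \<Rightarrow> 'k poly. f \<circ> g)"
  "one Weyl_algebra = (id :: 'k poly \<Rightarrow> 'k poly)"
  "zero Weyl_algebra = (\<lambda>p :: 'k poly. 0)"
  "add Weyl_algebra = (\<lambda>(f :: 'k poly \<Rightarrow> 'k poly) g p. f p + g p)"
  "module.smult Weyl_algebra = (\<lambda>k (f :: 'k poly \<Rightarrow> 'k poly) p. Polynomial.smult k (f p))"
  by (simp_all add: Weyl_algebra_def End_poly_def)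

lemma ring_Jacobian_algebra: "ring (Jacobian_algebra :: ('k::field_char_0, 'k poly \<Rightarrow> 'k poly) module)"
proof -
  have eq: "(Jacobian_algebra :: ('k, 'k poly \<Rightarrow> 'k poly) module) = End_poly\<lparr>carrier := Jacobian_ops\<rparr>"
    by (simp add: Jacobian_algebra_def)
  show ?thesis
    by (subst eq, subst carrier_Jacobian_algebra)
      (rule End_poly.generate_ring_is_ring[OF Jacobian_generators_carrier])
qed

lemma ring_Weyl_algebra: "ring (Weyl_algebra :: ('k::field, 'k poly \<Rightarrow> 'k poly) module)"
proof -
  have eq: "(Weyl_algebra :: ('k, 'k poly \<Rightarrow> 'k poly) module) = End_poly\<lparr>carrier := Weyl_ops\<rparr>"
    by (simp add: Weyl_algebra_def)
  show ?thesis
    by (subst eq, subst carrier_Weyl_algebra)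
      (rule End_poly.generate_ring_is_ring[OF Weyl_generators_carrier])
qed

section \<open>Regular elements and their Ore conditions\<close>

lemma left_regular_Jacobian:
  "c \<in> left_regular_elements Jacobian_algebra \<longleftrightarrow>
     c \<in> Jacobian_ops \<and> (\<forall>r\<in>Jacobian_ops. r \<circ> c = (\<lambda>p. 0) \<longrightarrow> r = (\<lambda>p. 0))"
  by (simp only: left_regular_elements_def Jacobian_algebra_simps mem_Collect_eq)

lemma regular_Weyl:
  fixes c :: "'k::field_char_0 poly \<Rightarrow> 'k poly"
  shows "c \<in> regular_elements Weyl_algebra \<longleftrightarrow> c \<in> Weyl_ops \<and> c \<noteq> (\<lambda>p. 0)"
proof -
  have "id \<circ> c \<noteq> (\<lambda>p. 0)" if "c \<in> regular_elements Weyl_algebra"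
    using that id_in_Weyl id_nonzero unfolding regular_elements_def Weyl_algebra_simps by blast
  moreover have "c \<in> regular_elements Weyl_algebra" if "c \<in> Weyl_ops" "c \<noteq> (\<lambda>p. 0)"
    using that Weyl_domain unfolding regular_elements_def Weyl_algebra_simps by blast
  moreover have "c \<in> Weyl_ops" if "c \<in> regular_elements Weyl_algebra"
    using that unfolding regular_elements_def by blast
  ultimately show ?thesis
    by (metis id_comp)
qed

lemma Jacobian_sub:
  assumes "f \<in> Jacobian_ops" "g \<in> Jacobian_ops"
  shows "(\<lambda>p. f p - g p) \<in> Jacobian_ops"
proof -
  have "(\<lambda>p. f p + Polynomial.smult (-1) (g p)) \<in> Jacobian_ops"
    using generate_ring.eng_add[of f End_poly _ "\<lambda>p. Polynomial.smult (-1) (g p)"]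
      assms smult_in_Jacobian[OF assms(2), of "-1"]
    by (simp add: carrier_Jacobian_algebra)
  then show ?thesis by simp
qed

lemma diff_fun_eq_zero_iff:
  fixes a b :: "'k::field poly \<Rightarrow> 'k poly"
  shows "(\<lambda>p. a p - b p) = (\<lambda>p. 0) \<longleftrightarrow> a = b"
  by (auto simp: fun_eq_iff)

lemma Jacobian_common_clear:
  fixes r s :: "'k::field_char_0 poly \<Rightarrow> 'k poly"
  assumes "r \<in> Jacobian_ops" "s \<in> Jacobian_ops"
  shows "\<exists>u\<in>Weyl_ops. u \<noteq> (\<lambda>p. 0) \<and> u \<circ> r \<in> Weyl_ops \<and> u \<circ> s \<in> Weyl_ops"
proof -
  obtain u where u: "u \<in> Weyl_ops" "u \<noteq> (\<lambda>p. 0)" "u \<circ> r \<in> Weyl_ops"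
    using Jacobian_clear_left[OF assms(1) id_in_Weyl] by (metis comp_id)
  obtain w where w: "w \<in> Weyl_ops" "w \<noteq> (\<lambda>p. 0)" "w \<circ> u \<circ> s \<in> Weyl_ops"
    using Jacobian_clear_left[OF assms(2) u(1)] by blast
  have "w \<circ> u \<circ> r \<in> Weyl_ops"
    using comp_in_Weyl[OF w(1) u(3)] by (simp only: comp_assoc)
  then show ?thesis
    using comp_in_Weyl[OF w(1) u(1)] Weyl_comp_nonzero[OF w(1) u(1) w(2) u(2)] w(3) by blast
qed

lemma Weyl_into_left_regular:
  fixes t :: "'k::field_char_0 poly \<Rightarrow> 'k poly"
  assumes "t \<in> Weyl_ops" "t \<noteq> (\<lambda>p. 0)"
  shows "\<exists>c\<in>Weyl_ops. c \<circ> t \<in> left_regular_elements Jacobian_algebra"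
proof -
  obtain a where "\<forall>r\<in>Jacobian_ops. r \<circ> (pderiv ^^ a \<circ> t) = (\<lambda>p. 0) \<longrightarrow> r = (\<lambda>p. 0)"
    using pderiv_power_comp_left_regular[OF assms] by blast
  moreover have "pderiv ^^ a \<circ> t \<in> Jacobian_ops"
    using comp_in_Weyl[OF pderiv_power_in_Weyl assms(1)] Weyl_subset_Jacobian by blast
  ultimately have "pderiv ^^ a \<circ> t \<in> left_regular_elements Jacobian_algebra"
    unfolding left_regular_Jacobian by blast
  then show ?thesis using pderiv_power_in_Weyl by blast
qed

lemma left_regular_Jacobian_comp_nonzero:
  fixes s u :: "'k::field_char_0 poly \<Rightarrow> 'k poly"
  assumes "s \<in> left_regular_elements Jacobian_algebra" "u \<in> Weyl_ops" "u \<noteq> (\<lambda>p. 0)"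
  shows "u \<circ> s \<noteq> (\<lambda>p. 0)"
  using assms Weyl_subset_Jacobian unfolding left_regular_Jacobian by blast

text \<open>Left cancellation fails in the whole Jacobian algebra, but holds against Weyl operators:
  some multiple \<open>u t\<close> is a nonzero Weyl operator, and these form a domain.\<close>

lemma left_regular_Jacobian_left_cancel:
  fixes t z z' :: "'k::field_char_0 poly \<Rightarrow> 'k poly"
  assumes t: "t \<in> left_regular_elements Jacobian_algebra" and z: "z \<in> Weyl_ops" "z' \<in> Weyl_ops"
    and eq: "t \<circ> z = t \<circ> z'"
  shows "z = z'"
proof -
  have tJ: "t \<in> Jacobian_ops"
    using t unfolding left_regular_Jacobian by blast
  obtain u where u: "u \<in> Weyl_ops" "u \<noteq> (\<lambda>p. 0)" "u \<circ> t \<in> Weyl_ops"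
    using Jacobian_common_clear[OF tJ tJ] by blast
  let ?z = "\<lambda>p. z p + Polynomial.smult (-1) (z' p)"
  have "?z \<in> Weyl_ops"
    by (intro add_in_Weyl smult_in_Weyl z)
  moreover have "u \<circ> t \<circ> ?z = (\<lambda>p. 0)"
  proof
    fix p
    have eq': "(u \<circ> t) (z p) = (u \<circ> t) (z' p)"
      using arg_cong[OF fun_cong[OF eq, of p], of u] by (simp only: comp_apply)
    have "(u \<circ> t \<circ> ?z) p = (u \<circ> t) (z p) + Polynomial.smult (-1) ((u \<circ> t) (z' p))"
      by (simp only: comp_apply[of "u \<circ> t" ?z] Weyl_smult_add[OF u(3)])
    also have "\<dots> = 0"
      unfolding eq' by simp
    finally show "(u \<circ> t \<circ> ?z) p = 0" .
  qed
  ultimately have "?z = (\<lambda>p. 0)"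
    using Weyl_domain[OF u(3)] left_regular_Jacobian_comp_nonzero[OF t u(1,2)] by blast
  then show ?thesis
    by (simp add: fun_eq_iff)
qed

text \<open>After clearing with \<open>u\<close>, the Ore condition of the Weyl algebra gives
  \<open>p u r = q u s\<close>. The multiplier \<open>p u\<close> is nonzero but possibly not left
  regular; a further factor \<open>c\<close> repairs this.\<close>

lemma left_regular_Jacobian_Ore:
  fixes r s :: "'k::field_char_0 poly \<Rightarrow> 'k poly"
  assumes r: "r \<in> Jacobian_ops" and s: "s \<in> left_regular_elements Jacobian_algebra"
  shows "\<exists>t\<in>left_regular_elements Jacobian_algebra. \<exists>a\<in>Jacobian_ops. t \<circ> r = a \<circ> s"
proof -
  have sJ: "s \<in> Jacobian_ops"
    using s unfolding left_regular_Jacobian by blast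
  obtain u where u: "u \<in> Weyl_ops" "u \<noteq> (\<lambda>p. 0)" "u \<circ> r \<in> Weyl_ops" "u \<circ> s \<in> Weyl_ops"
    using Jacobian_common_clear[OF r sJ] by blast
  obtain p q where pq: "p \<in> Weyl_ops" "q \<in> Weyl_ops" "p \<noteq> (\<lambda>p. 0)" "p \<circ> (u \<circ> r) = q \<circ> (u \<circ> s)"
    using Weyl_left_Ore[OF u(3,4) left_regular_Jacobian_comp_nonzero[OF s u(1,2)]] by blast
  obtain c where c: "c \<in> Weyl_ops" "c \<circ> (p \<circ> u) \<in> left_regular_elements Jacobian_algebra"
    using Weyl_into_left_regular[OF comp_in_Weyl[OF pq(1) u(1)] Weyl_comp_nonzero[OF pq(1) u(1) pq(3) u(2)]]
    by blast
  have "c \<circ> (p \<circ> u) \<circ> r = c \<circ> (q \<circ> u) \<circ> s"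
    using pq(4) by (metis comp_assoc)
  moreover have "c \<circ> (q \<circ> u) \<in> Jacobian_ops"
    using comp_in_Weyl[OF c(1) comp_in_Weyl[OF pq(2) u(1)]] Weyl_subset_Jacobian by blast
  ultimately show ?thesis using c(2) by blast
qed

lemma comp_smult_Jacobian:
  assumes "f \<in> Jacobian_ops"
  shows "f \<circ> (\<lambda>p. Polynomial.smult k (g p)) = (\<lambda>p. Polynomial.smult k ((f \<circ> g) p))"
  using Jacobian_linear[OF assms] by (simp add: linear_smult_iff fun_eq_iff)

lemma Jacobian_cancellative_left_Ore_set:
  "cancellative_left_Ore_set (Jacobian_algebra :: ('k::field_char_0, 'k poly \<Rightarrow> 'k poly) module)
     (left_regular_elements Jacobian_algebra)"
proof (rule cancellative_left_Ore_set.intro[OF ring_Jacobian_algebra cancellative_left_Ore_set_axioms.intro],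
    unfold Jacobian_algebra_simps)
  show "left_regular_elements Jacobian_algebra \<subseteq> (Jacobian_ops :: ('k poly \<Rightarrow> 'k poly) set)"
    unfolding left_regular_elements_def by blast
  show "(id :: 'k poly \<Rightarrow> 'k poly) \<in> left_regular_elements Jacobian_algebra"
    unfolding left_regular_Jacobian using id_in_Weyl Weyl_subset_Jacobian by auto
  fix s t :: "'k poly \<Rightarrow> 'k poly"
  assume s: "s \<in> left_regular_elements Jacobian_algebra"
  show "s \<circ> t \<in> left_regular_elements Jacobian_algebra"
    if t: "t \<in> left_regular_elements Jacobian_algebra"
    unfolding left_regular_Jacobian
  proof (intro conjI ballI impI)
    show "s \<circ> t \<in> Jacobian_ops"
      using s t comp_in_Jacobian unfolding left_regular_Jacobian by blast
    fix r :: "'k poly \<Rightarrow> 'k poly" assume r: "r \<in> Jacobian_ops" "r \<circ> (s \<circ> t) = (\<lambda>p. 0)"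
    then have "r \<circ> s = (\<lambda>p. 0)"
      using t s comp_in_Jacobian[OF r(1), of s] unfolding left_regular_Jacobian
      by (metis comp_assoc)
    then show "r = (\<lambda>p. 0)"
      using s r(1) unfolding left_regular_Jacobian by blast
  qed
  show "\<exists>t\<in>left_regular_elements Jacobian_algebra. \<exists>a\<in>Jacobian_ops. t \<circ> r = a \<circ> s" if "r \<in> Jacobian_ops" for r
    using left_regular_Jacobian_Ore[OF that s] .
  show "a = b" if ab: "a \<in> Jacobian_ops" "b \<in> Jacobian_ops" "a \<circ> s = b \<circ> s" for a b
  proof -
    have "(\<lambda>p. a p - b p) \<circ> s = (\<lambda>p. 0)"
      using fun_cong[OF ab(3)] by (simp add: fun_eq_iff)
    then have "(\<lambda>p. a p - b p) = (\<lambda>p. 0)"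
      using s Jacobian_sub[OF ab(1,2)] unfolding left_regular_Jacobian by blast
    then show ?thesis unfolding diff_fun_eq_zero_iff .
  qed
next
  fix k and r :: "'k poly \<Rightarrow> 'k poly"
  assume "r \<in> Jacobian_ops"
  then show "(\<lambda>p. Polynomial.smult k (r p)) \<in> Jacobian_ops"
    by (rule smult_in_Jacobian)
next
  fix k and a r :: "'k poly \<Rightarrow> 'k poly"
  assume "a \<in> Jacobian_ops"
  then show "a \<circ> (\<lambda>p. Polynomial.smult k (r p)) = (\<lambda>p. Polynomial.smult k ((a \<circ> r) p))"
    by (rule comp_smult_Jacobian)
qed

lemma Weyl_cancellative_left_Ore_set:
  "cancellative_left_Ore_set (Weyl_algebra :: ('k::field_char_0, 'k poly \<Rightarrow> 'k poly) module)
     (regular_elements Weyl_algebra)"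
proof (rule cancellative_left_Ore_set.intro[OF ring_Weyl_algebra cancellative_left_Ore_set_axioms.intro],
    unfold Weyl_algebra_simps)
  show "regular_elements Weyl_algebra \<subseteq> (Weyl_ops :: ('k poly \<Rightarrow> 'k poly) set)"
    unfolding regular_elements_def by blast
  show "(id :: 'k poly \<Rightarrow> 'k poly) \<in> regular_elements Weyl_algebra"
    unfolding regular_Weyl using id_in_Weyl id_nonzero by blast
  fix s t :: "'k poly \<Rightarrow> 'k poly"
  assume s: "s \<in> regular_elements Weyl_algebra"
  show "s \<circ> t \<in> regular_elements Weyl_algebra" if t: "t \<in> regular_elements Weyl_algebra"
    using s t comp_in_Weyl Weyl_comp_nonzero unfolding regular_Weyl by blast
  show "\<exists>t\<in>regular_elements Weyl_algebra. \<exists>a\<in>Weyl_ops. t \<circ> r = a \<circ> s" if "r \<in> Weyl_ops" for r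
    using Weyl_left_Ore[OF that] s unfolding regular_Weyl Bex_def by blast
  show "a = b" if ab: "a \<in> Weyl_ops" "b \<in> Weyl_ops" "a \<circ> s = b \<circ> s" for a b
  proof -
    have "(\<lambda>p. a p - b p) \<in> Weyl_ops"
      using add_in_Weyl[OF ab(1) minus_in_Weyl[OF ab(2)]] by simp
    moreover have "(\<lambda>p. a p - b p) \<circ> s = (\<lambda>p. 0)"
      using fun_cong[OF ab(3)] by (simp add: fun_eq_iff)
    ultimately have "(\<lambda>p. a p - b p) = (\<lambda>p. 0)"
      using Weyl_domain s unfolding regular_Weyl by blast
    then show ?thesis unfolding diff_fun_eq_zero_iff .
  qed
next
  fix k and r :: "'k poly \<Rightarrow> 'k poly"
  assume "r \<in> Weyl_ops"
  then show "(\<lambda>p. Polynomial.smult k (r p)) \<in> Weyl_ops"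
    by (rule smult_in_Weyl)
next
  fix k and a r :: "'k poly \<Rightarrow> 'k poly"
  assume "a \<in> Weyl_ops"
  then show "a \<circ> (\<lambda>p. Polynomial.smult k (r p)) = (\<lambda>p. Polynomial.smult k ((a \<circ> r) p))"
    using comp_smult_Jacobian Weyl_subset_Jacobian by blast
qed

text \<open>The upper bound is itself a left denominator set, so it is the greatest one.\<close>

lemma largest_left_regular_denominator_set_Jacobian:
  "largest_left_regular_denominator_set
     (Jacobian_algebra :: ('k::field_char_0, 'k poly \<Rightarrow> 'k poly) module) =
   left_regular_elements Jacobian_algebra"
  unfolding largest_left_regular_denominator_set_def
proof (rule Greatest_equality)
  have "zero (Jacobian_algebra :: ('k, 'k poly \<Rightarrow> 'k poly) module) \<notin> left_regular_elements Jacobian_algebra"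
  proof
    assume "zero (Jacobian_algebra :: ('k, 'k poly \<Rightarrow> 'k poly) module) \<in> left_regular_elements Jacobian_algebra"
    then have "(\<lambda>p :: 'k poly. 0) \<in> left_regular_elements Jacobian_algebra"
      by (simp only: Jacobian_algebra_simps)
    from left_regular_Jacobian_comp_nonzero[OF this id_in_Weyl id_nonzero] show False
      by simp
  qed
  then show "left_denominator_set (Jacobian_algebra :: ('k, 'k poly \<Rightarrow> 'k poly) module)
      (left_regular_elements Jacobian_algebra) \<and>
    left_regular_elements Jacobian_algebra \<subseteq>
      left_regular_elements (Jacobian_algebra :: ('k, 'k poly \<Rightarrow> 'k poly) module)"
    using cancellative_left_Ore_set.left_denominator_set[OF Jacobian_cancellative_left_Ore_set] by blast
qed blast

theorem theorem5p5:
  shows "algebra_isomorphic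
    (left_regular_left_quotient_ring
      (Jacobian_algebra :: ('k::field_char_0, 'k poly \<Rightarrow> 'k poly) module))
    (classical_left_quotient_ring
      (Weyl_algebra :: ('k, 'k poly \<Rightarrow> 'k poly) module))"
proof -
  let ?S = "left_regular_elements (Jacobian_algebra :: ('k, 'k poly \<Rightarrow> 'k poly) module)"
  let ?T = "regular_elements (Weyl_algebra :: ('k, 'k poly \<Rightarrow> 'k poly) module)"
  have "algebra_isomorphic (left_localization Jacobian_algebra ?S)
      (left_localization (Jacobian_algebra\<lparr>carrier := Weyl_ops\<rparr>) ?T)"
  proof (rule left_localization_subalgebra_iso, unfold Jacobian_algebra_simps)
    show "cancellative_left_Ore_set Jacobian_algebra ?S"
      by (rule Jacobian_cancellative_left_Ore_set)
    show "cancellative_left_Ore_set (Jacobian_algebra\<lparr>carrier := Weyl_ops\<rparr>) ?T"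
      using Weyl_cancellative_left_Ore_set by (simp only: Weyl_algebra_eq[symmetric])
    show "(Weyl_ops :: ('k poly \<Rightarrow> 'k poly) set) \<subseteq> Jacobian_ops"
      by (rule Weyl_subset_Jacobian)
    show "?S \<inter> Weyl_ops \<subseteq> ?T"
    proof
      fix c assume c: "c \<in> ?S \<inter> Weyl_ops"
      then have "c \<noteq> (\<lambda>p. 0)"
        using left_regular_Jacobian_comp_nonzero[OF _ id_in_Weyl id_nonzero, of c] by (metis IntD1 id_comp)
      with c show "c \<in> ?T"
        unfolding regular_Weyl by blast
    qed
    show "\<exists>u\<in>Jacobian_ops. u \<circ> s \<in> ?S \<inter> Weyl_ops \<and> u \<circ> r \<in> Weyl_ops" if s: "s \<in> ?S" and r: "r \<in> Jacobian_ops" for s r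
    proof -
      have "s \<in> Jacobian_ops"
        using s unfolding left_regular_Jacobian by blast
      then obtain u where u: "u \<in> Weyl_ops" "u \<noteq> (\<lambda>p. 0)" "u \<circ> r \<in> Weyl_ops" "u \<circ> s \<in> Weyl_ops"
        using Jacobian_common_clear[OF r] by blast
      \<comment> \<open>The cleared denominator \<open>u s\<close> can fall outside
        \<open>?S\<close>, since \<open>u\<close> need not be left regular; the factor
        \<open>c\<close> brings it back.\<close>
      obtain c where c: "c \<in> Weyl_ops" "c \<circ> (u \<circ> s) \<in> ?S"
        using Weyl_into_left_regular[OF u(4) left_regular_Jacobian_comp_nonzero[OF s u(1,2)]] by blast
      have "c \<circ> u \<in> Jacobian_ops"
        using comp_in_Weyl[OF c(1) u(1)] Weyl_subset_Jacobian by blast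
      moreover have "c \<circ> u \<circ> s \<in> ?S \<inter> Weyl_ops" "c \<circ> u \<circ> r \<in> Weyl_ops"
        using c comp_in_Weyl[OF c(1) u(3)] comp_in_Weyl[OF c(1) u(4)]
        by (simp_all only: comp_assoc Int_iff simp_thms)
      ultimately show ?thesis by blast
    qed
    show "\<exists>c\<in>Weyl_ops. c \<circ> t \<in> ?S" if "t \<in> ?T" for t
      using that Weyl_into_left_regular unfolding regular_Weyl by blast
    show "z = z'" if "t \<in> ?S" "z \<in> Weyl_ops" "z' \<in> Weyl_ops" "t \<circ> z = t \<circ> z'" for t z z'
      using left_regular_Jacobian_left_cancel[OF that] .
  qed
  then show ?thesis
    by (simp only: left_regular_left_quotient_ring_def classical_left_quotient_ring_def
        largest_left_regular_denominator_set_Jacobian Weyl_algebra_eq[symmetric])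
qed

end
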